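(* Assume $E[X_0^2]<\infty$ and $E[X_+^2]<\infty$. Then, for $t\ge0$, the variance of the sale price $S_t$, under the optimal policy, is finite and given by $$\mathrm{Var}[S_t]=\phi(\mu(t))\left[\frac{\mathrm{Var}[X_0]}{\phi(\mu_0)}+2\int_{\mu_0}^{\mu(t)}\frac{1}{\phi(w)^2}\int_w^\infty\phi(x)\,dx\,dw\right],$$ which can also be written as $$\mathrm{Var}[S_t]=E[(X-\mu(t))_+]\left[\mu(t)-\mu_0+\frac{\mathrm{Var}[X_0]}{E[(X-\mu_0)_+]}+\int_{\mu_0}^{\mu(t)}\frac{\mathrm{Var}[(X-w)_+]}{E[(X-w)_+]^2}\,dw\right].$$
   Context: Data: $\lambda>0$; $F,F_0$ are cumulative distribution functions (CDFs) on $\mathbb{R}$ (offer distribution and residual price distribution); $X\sim F$, $X_0\sim F_0$; $y_+=\max(y,0)$; $\mu_0=E[X_0]$; $M=\sup\{x : F(x)<1\}\in(-\infty,+\infty]$. Standing assumptions: $E[X_+]<\infty$, $E[|X_0|]<\infty$, $0\le\mu_0<M$. Define $\phi(x)=\int_x^\infty[1-F(u)]\,du$ and $\Psi(x)=\int_{\mu_0}^x\frac{du}{\phi(u)}$ for $x\in[\mu_0,M)$. The optimal policy is the function $\mu:[0,\infty)\to[\mu_0,M)$, $\mu(t)=\Psi^{-1}(\lambda t)$; equivalently, the solution of $\mu'(t)=\lambda\phi(\mu(t))$, $\mu(0)=\mu_0$. Bidding process with marketing period $t\ge 0$ under the optimal policy: let $D_1,D_2,\dots$ be exponential with rate $\lambda$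 (inter-arrival times of offers), $X_1,X_2,\dots$ be distributed according to $F$ (offer values), and $X_0$ be distributed according to $F_0$, all independent. The time remaining to the deadline when the $i$-th offer arrives is $t_i=\max(t_{i-1}-D_i,0)$, with initial value $t$ (that is, $t_i=(t-D_1-\dots-D_i)_+$). An offer $X_i$ with $t_i>0$ is accepted if and only if $X_i\ge\mu(t_i)$; at the first accepted offer $i$ the process ends, with realized sale price $S_t=X_i$. If no offer is accepted before the remaining time reaches $0$, then $S_t=X_0$. *)

theory Defs
  imports "HOL-Probability.Probability"
begin

definition tail_integral :: "(real \<Rightarrow> real) \<Rightarrow> real \<Rightarrow> real" where
  "tail_integral F x = (LBINT u=ereal x..\<infinity>. 1 - F u)"

definition upper_endpoint :: "(real \<Rightarrow> real) \<Rightarrow> ereal" where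
  "upper_endpoint F = Sup (ereal ` {x. F x < 1})"

definition Psi :: "(real \<Rightarrow> real) \<Rightarrow> real \<Rightarrow> real \<Rightarrow> real" where
  "Psi F m x = (LBINT u=ereal m..ereal x. 1 / tail_integral F u)"

text \<open>
  The inverse of \<open>Psi F m\<close> is taken on its domain, the interval from \<open>m\<close> (included)
  to \<open>upper_endpoint F\<close> (excluded, possibly infinite).
\<close>

definition optimal_policy :: "real \<Rightarrow> (real \<Rightarrow> real) \<Rightarrow> real \<Rightarrow> real \<Rightarrow> real" where
  "optimal_policy lam F m t =
     the_inv_into {x. m \<le> x \<and> ereal x < upper_endpoint F} (Psi F m) (lam * t)"

text \<open>
  \<open>X 0\<close> is the residual price and \<open>X i\<close> for \<open>i \<ge> 1\<close> are the offers; \<open>D i\<close> for \<open>i \<ge> 1\<close> are the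
  inter-arrival times (\<open>D 0\<close> is unused). \<open>Y\<close> is a generic offer value, used only for its law \<open>F\<close>;
  nothing is assumed about its dependence on the other variables. That \<open>F\<close> and \<open>F0\<close> are
  cumulative distribution functions is part of \<open>Y_cdf\<close> and \<open>X_0_cdf\<close>. The expectation of
  \<open>X 0\<close> is the initial value of the policy.
\<close>

locale bidding_process = prob_space M
  for M :: "'a measure" +
  fixes lam :: real and F F0 :: "real \<Rightarrow> real" and Y :: "'a \<Rightarrow> real"
    and X D :: "nat \<Rightarrow> 'a \<Rightarrow> real"
  assumes rate_pos: "lam > 0"
    and Y_measurable: "random_variable borel Y"
    and Y_cdf: "cdf (distr M borel Y) = F"
    and X_0_measurable: "random_variable borel (X 0)"
    and X_0_cdf: "cdf (distr M borel (X 0)) = F0"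
    and X_measurable: "\<And>i. i \<ge> 1 \<Longrightarrow> random_variable borel (X i)"
    and X_cdf: "\<And>i. i \<ge> 1 \<Longrightarrow> cdf (distr M borel (X i)) = F"
    and D_exponential: "\<And>i. i \<ge> 1 \<Longrightarrow> distributed M lborel (D i) (exponential_density lam)"
    and independent: "indep_vars (\<lambda>_. borel) (case_sum X D) (UNIV <+> {1..})"
    and Y_pos_integrable: "integrable M (\<lambda>\<omega>. max (Y \<omega>) 0)"
    and X_0_integrable: "integrable M (X 0)"
    and mean_nonneg: "0 \<le> expectation (X 0)"
    and mean_less: "ereal (expectation (X 0)) < upper_endpoint F"

primrec remaining_time :: "(nat \<Rightarrow> 'a \<Rightarrow> real) \<Rightarrow> real \<Rightarrow> nat \<Rightarrow> 'a \<Rightarrow> real" where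
  "remaining_time D t 0 \<omega> = t"
| "remaining_time D t (Suc i) \<omega> = max (remaining_time D t i \<omega> - D (Suc i) \<omega>) 0"

definition accepted ::
  "(real \<Rightarrow> real) \<Rightarrow> (nat \<Rightarrow> 'a \<Rightarrow> real) \<Rightarrow> (nat \<Rightarrow> 'a \<Rightarrow> real) \<Rightarrow> real \<Rightarrow> nat \<Rightarrow> 'a \<Rightarrow> bool" where
  "accepted \<mu> X D t i \<omega> \<longleftrightarrow>
     i \<ge> 1 \<and> remaining_time D t i \<omega> > 0 \<and> X i \<omega> \<ge> \<mu> (remaining_time D t i \<omega>)"

definition sale_price ::
  "(real \<Rightarrow> real) \<Rightarrow> (nat \<Rightarrow> 'a \<Rightarrow> real) \<Rightarrow> (nat \<Rightarrow> 'a \<Rightarrow> real) \<Rightarrow> real \<Rightarrow> 'a \<Rightarrow> real" where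
  "sale_price \<mu> X D t \<omega> =
     (if \<exists>i. accepted \<mu> X D t i \<omega> then X (LEAST i. accepted \<mu> X D t i \<omega>) \<omega> else X 0 \<omega>)"

end

theory Submission
  imports Defs
begin

text \<open>
  Fix the marketing period \<open>t\<close> and write \<open>s\<^sub>n\<close> for the time left after \<open>n\<close> offers.  For a payoff
  \<open>g\<close> let \<open>v r\<close> be the expected value of \<open>g\<close> at the sale price when the time left is \<open>r\<close>.
  Conditioning on the first arrival, which is exponential, gives the renewal equation
  \<open>exp (lam * s) * v s = v 0 + \<integral>\<^sub>0\<^sup>s lam * exp (lam * r) * K r dr\<close> with
  \<open>K r = E [if \<mu> r \<le> Y then g Y else v r]\<close>.  The proof uses it in the opposite direction: every
  bounded solution of this equation is the expected payoff.  If \<open>v\<close> is a solution, then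
  \<open>(payoff already collected) + 1[unsold after n offers] * v s\<^sub>n\<close> has an expectation that does not
  depend on \<open>n\<close>, since the next offer is independent of the past.  The probability that
  \<open>s\<^sub>n > 0\<close> tends to \<open>0\<close> geometrically, so letting \<open>n\<close> tend to infinity replaces the last term by
  the residual payoff.  This is \<open>expectation_sale_price\<close>; it holds for any threshold policy.
  
  For the optimal policy, \<open>\<mu>' = lam * \<phi> \<mu>\<close> says that \<open>\<mu>\<close> itself solves the equation for \<open>g x = x\<close>,
  hence the mean price is \<open>\<mu> t\<close> (\<open>mean_equation\<close>).  For \<open>g x = x\<^sup>2\<close> put \<open>v = \<mu>\<^sup>2 + V\<close>.  Formally
  the equation becomes the linear equation
  \<open>V' = lam * (2 * \<Phi> \<mu> - P (Y \<ge> \<mu>) * V)\<close>, where \<open>\<Phi> w = \<integral>\<^sub>w\<^sup>\<infinity> \<phi> = E [((Y - w)\<^sub>+)\<^sup>2] / 2\<close>.  Since \<open>\<phi>' = - P (Y > x)\<close>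
  away from the atoms of \<open>F\<close>, \<open>\<phi> \<circ> \<mu>\<close> solves the homogeneous equation, and variation of constants gives
  \<open>V = \<phi> \<mu> * U\<close> with \<open>U' = 2 * lam * \<Phi> \<mu> / \<phi> \<mu>\<close>; the substitution \<open>w = \<mu> r\<close> turns the integral of
  \<open>U'\<close> into the one of the statement.
  
  The distribution \<open>F\<close> may have infinitely many atoms, and \<open>\<phi> \<circ> \<mu>\<close> then has infinitely many kinks.
  The fundamental theorem of calculus is therefore not applied to \<open>\<phi> \<circ> \<mu>\<close>.  For a single value \<open>y\<close> of
  the offer, the function \<open>(y - \<mu> r)\<^sub>+\<close> has just one kink; the theorem is applied to it
  (\<open>second_moment_kernel\<close>), and the result is averaged over \<open>y\<close> with Fubini's theorem
  (\<open>second_moment_equation\<close>).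
  
  The second form of the variance follows from the first: as \<open>\<phi> w = E [(Y - w)\<^sub>+]\<close>, the quotient
  \<open>Var [(Y - w)\<^sub>+] / E [(Y - w)\<^sub>+]\<^sup>2\<close> equals \<open>2 * \<Phi> w / (\<phi> w)\<^sup>2 - 1\<close>.
\<close>

section \<open>The bidding process under a threshold policy\<close>

text \<open>
  The law of the pair is a product measure, so Fubini's theorem integrates out the independent
  component first.
\<close>

lemma (in prob_space) expectation_indep_split:
  fixes f :: "'b \<times> 'b \<Rightarrow> real"
  assumes ind: "indep_var N U N' A"
    and f: "f \<in> borel_measurable (N \<Otimes>\<^sub>M N')"
    and int: "integrable M (\<lambda>\<omega>. f (U \<omega>, A \<omega>))"
  shows "expectation (\<lambda>\<omega>. f (U \<omega>, A \<omega>)) = expectation (\<lambda>\<omega>. \<integral>a. f (U \<omega>, a) \<partial>distr M N' A)"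
proof -
  have U[measurable]: "U \<in> measurable M N" and A[measurable]: "A \<in> measurable M N'"
    using indep_var_rv1[OF ind] indep_var_rv2[OF ind] by auto
  note [measurable] = f
  interpret P1: prob_space "distr M N U" by (rule prob_space_distr[OF U])
  interpret P2: prob_space "distr M N' A" by (rule prob_space_distr[OF A])
  interpret P: pair_prob_space "distr M N U" "distr M N' A" ..
  have joint: "distr M N U \<Otimes>\<^sub>M distr M N' A = distr M (N \<Otimes>\<^sub>M N') (\<lambda>\<omega>. (U \<omega>, A \<omega>))"
    using ind by (simp add: indep_var_distribution_eq)
  have int': "integrable (distr M N U \<Otimes>\<^sub>M distr M N' A) f"
    unfolding joint by (subst integrable_distr_eq) (use int in auto)
  have "expectation (\<lambda>\<omega>. f (U \<omega>, A \<omega>)) = (\<integral>z. f z \<partial>(distr M N U \<Otimes>\<^sub>M distr M N' A))"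
    unfolding joint by (subst integral_distr) auto
  also have "\<dots> = (\<integral>u. (\<integral>a. f (u, a) \<partial>distr M N' A) \<partial>distr M N U)"
    by (rule P.integral_fst'[OF int', symmetric])
  also have "\<dots> = expectation (\<lambda>\<omega>. \<integral>a. f (U \<omega>, a) \<partial>distr M N' A)"
    by (subst integral_distr) auto
  finally show ?thesis .
qed

definition unsold ::
  "(real \<Rightarrow> real) \<Rightarrow> (nat \<Rightarrow> 'a \<Rightarrow> real) \<Rightarrow> (nat \<Rightarrow> 'a \<Rightarrow> real) \<Rightarrow> real \<Rightarrow> nat \<Rightarrow> 'a \<Rightarrow> bool" where
  "unsold m X D t n \<omega> \<longleftrightarrow> (\<forall>i\<le>n. \<not> accepted m X D t i \<omega>)"

lemma unsold_0 [simp]: "unsold m X D t 0 \<omega>"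
  by (simp add: unsold_def accepted_def)

lemma unsold_Suc:
  "unsold m X D t (Suc n) \<omega> \<longleftrightarrow> unsold m X D t n \<omega> \<and> \<not> accepted m X D t (Suc n) \<omega>"
  by (auto simp: unsold_def le_Suc_eq)

lemma remaining_time_nonneg: "t \<ge> 0 \<Longrightarrow> remaining_time D t n \<omega> \<ge> 0"
  by (cases n) auto

lemma remaining_time_le:
  assumes "t \<ge> 0" "\<And>i. i \<ge> 1 \<Longrightarrow> D i \<omega> \<ge> 0"
  shows "remaining_time D t n \<omega> \<le> t"
proof (induction n)
  case (Suc n)
  then show ?case using assms(1) assms(2)[of "Suc n"] by auto
qed simp

text \<open>
  As long as time is left, the waiting times add up to less than \<open>t\<close>.  The bound for each of them
  separately suffices to make a long sequence of offers unlikely.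
\<close>

lemma waiting_time_less:
  assumes "t \<ge> 0" "\<And>i. i \<ge> 1 \<Longrightarrow> D i \<omega> \<ge> 0" "remaining_time D t n \<omega> > 0" "1 \<le> i" "i \<le> n"
  shows "D i \<omega> \<le> t"
  using assms(3-5)
proof (induction n)
  case (Suc n)
  have *: "remaining_time D t n \<omega> - D (Suc n) \<omega> > 0" using Suc.prems(1) by auto
  show ?case
  proof (cases "i = Suc n")
    case True
    with * remaining_time_le[of t D \<omega> n] assms(1,2) show ?thesis by auto
  next
    case False
    have "remaining_time D t n \<omega> > 0" using * assms(2)[of "Suc n"] by auto
    with Suc False show ?thesis by auto
  qed
qed simp

text \<open>
  The next three lemmas say that the state after \<open>n\<close> offers is determined by the first \<open>n\<close> offers and
  waiting times.  They compare different sample spaces because the independence argument reads off the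
  state from the tuple of these variables.
\<close>

lemma remaining_time_cong:
  "(\<And>i. 1 \<le> i \<Longrightarrow> i \<le> n \<Longrightarrow> D i \<omega> = D' i \<omega>') \<Longrightarrow> remaining_time D t n \<omega> = remaining_time D' t n \<omega>'"
  by (induction n) auto

lemma accepted_cong:
  assumes "\<And>i. 1 \<le> i \<Longrightarrow> i \<le> n \<Longrightarrow> D i \<omega> = D' i \<omega>'" "\<And>i. 1 \<le> i \<Longrightarrow> i \<le> n \<Longrightarrow> X i \<omega> = X' i \<omega>'"
  shows "accepted m X D t n \<omega> = accepted m X' D' t n \<omega>'"
  using remaining_time_cong[of n D \<omega> D' \<omega>' t] assms by (auto simp: accepted_def)

lemma unsold_cong:
  assumes "\<And>i. 1 \<le> i \<Longrightarrow> i \<le> n \<Longrightarrow> D i \<omega> = D' i \<omega>'" "\<And>i. 1 \<le> i \<Longrightarrow> i \<le> n \<Longrightarrow> X i \<omega> = X' i \<omega>'"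
  shows "unsold m X D t n \<omega> = unsold m X' D' t n \<omega>'"
  using accepted_cong[of _ D \<omega> D' \<omega>' X X' m t] assms by (auto simp: unsold_def)

lemma remaining_time_0_fun: "remaining_time D t 0 = (\<lambda>_. t)"
  by (simp add: fun_eq_iff)

lemma measurable_remaining_time:
  assumes "\<And>i. 1 \<le> i \<Longrightarrow> i \<le> n \<Longrightarrow> D i \<in> borel_measurable N"
  shows "remaining_time D t n \<in> borel_measurable N"
  using assms
proof (induction n)
  case (Suc n)
  have [measurable]: "remaining_time D t n \<in> borel_measurable N" "D (Suc n) \<in> borel_measurable N"
    using Suc by auto
  show ?case by simp
qed (simp add: remaining_time_0_fun)

lemma pred_accepted:
  assumes [measurable]: "m \<in> borel_measurable borel"
    and D: "\<And>i. 1 \<le> i \<Longrightarrow> i \<le> n \<Longrightarrow> D i \<in> borel_measurable N"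
    and X: "\<And>i. 1 \<le> i \<Longrightarrow> i \<le> n \<Longrightarrow> X i \<in> borel_measurable N"
  shows "Measurable.pred N (accepted m X D t n)"
proof (cases "n \<ge> 1")
  case True
  have [measurable]: "remaining_time D t n \<in> borel_measurable N" "X n \<in> borel_measurable N"
    by (rule measurable_remaining_time, rule D) (use X True in auto)
  show ?thesis unfolding accepted_def by measurable
next
  case False
  then have "accepted m X D t n = (\<lambda>_. False)" by (simp add: accepted_def fun_eq_iff)
  then show ?thesis by simp
qed

lemma pred_unsold:
  assumes m: "m \<in> borel_measurable borel"
    and D: "\<And>i. 1 \<le> i \<Longrightarrow> i \<le> n \<Longrightarrow> D i \<in> borel_measurable N"
    and X: "\<And>i. 1 \<le> i \<Longrightarrow> i \<le> n \<Longrightarrow> X i \<in> borel_measurable N"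
  shows "Measurable.pred N (unsold m X D t n)"
  using D X
proof (induction n)
  case (Suc n)
  have [measurable]: "Measurable.pred N (accepted m X D t (Suc n))"
    by (rule pred_accepted[OF m]) (use Suc.prems in auto)
  have [measurable]: "Measurable.pred N (unsold m X D t n)"
    using Suc by auto
  show ?case unfolding unsold_Suc by measurable
next
  case 0
  have "unsold m X D t 0 = (\<lambda>_. True)" by (simp add: fun_eq_iff)
  then show ?case by simp
qed

text \<open>
  This writes the payoff of a sale, which refers to the first accepted offer, as a sum over the
  offers with at most one nonzero term.
\<close>

lemma unsold_accepted_iff_first:
  "unsold m X D t i \<omega> \<and> accepted m X D t (Suc i) \<omega> \<longleftrightarrow>
     (\<exists>k. accepted m X D t k \<omega>) \<and> (LEAST k. accepted m X D t k \<omega>) = Suc i" (is "?L \<longleftrightarrow> ?R")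
proof
  assume L: ?L
  then have "(LEAST k. accepted m X D t k \<omega>) = Suc i"
    by (intro Least_equality) (auto simp: unsold_def not_less_eq_eq)
  with L show ?R by auto
next
  assume R: ?R
  then have "accepted m X D t (Suc i) \<omega>"
    using LeastI_ex[of "\<lambda>k. accepted m X D t k \<omega>"] by simp
  moreover have "\<not> accepted m X D t k \<omega>" if "k \<le> i" for k
    using not_less_Least[of k "\<lambda>k. accepted m X D t k \<omega>"] R that by simp
  ultimately show ?L by (simp add: unsold_def)
qed

context bidding_process
begin

lemma offer_law: "i \<ge> 1 \<Longrightarrow> distr M borel (X i) = distr M borel Y"
  using X_measurable Y_measurable X_cdf Y_cdf by (intro cdf_unique) auto

lemma measurable_waiting_time [measurable]: "i \<ge> 1 \<Longrightarrow> D i \<in> borel_measurable M"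
  using distributed_measurable[OF D_exponential[of i]] by simp

text \<open>
  Only an almost sure statement is possible: on a null set waiting times may be negative and the time
  left may exceed \<open>t\<close>.
\<close>

lemma AE_waiting_time_pos: "AE \<omega> in M. \<forall>i\<ge>1. D i \<omega> > 0"
proof -
  have "AE \<omega> in M. D i \<omega> > 0" if "i \<ge> 1" for i
  proof -
    have [measurable]: "D i \<in> borel_measurable M" using that by simp
    have "prob {\<omega> \<in> space M. 0 < D i \<omega>} = 1"
      using exponential_distributedD_gt[OF D_exponential[OF that], of 0] rate_pos by simp
    then show ?thesis by (subst (asm) prob_Collect_eq_1) auto
  qed
  then show ?thesis by (subst AE_all_countable) auto
qed

text \<open>
  The next variable \<open>j\<close> is independent of the state formed from the first \<open>n\<close> offers and \<open>k\<close> waiting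
  times, so it can be averaged first.  Two counters are needed because within one step
  the waiting time \<open>n + 1\<close> is observed before the offer \<open>n + 1\<close>.
\<close>

lemma expectation_past_split:
  fixes f :: "(real \<times> real) \<times> real \<Rightarrow> real"
  assumes m: "m \<in> borel_measurable borel" and "n \<le> k"
    and j: "j \<in> UNIV <+> {1..}" "j \<notin> Inl ` {1..n} \<union> Inr ` {1..k}"
    and f [measurable]: "f \<in> borel_measurable ((borel \<Otimes>\<^sub>M borel) \<Otimes>\<^sub>M borel)"
    and int: "integrable M (\<lambda>\<omega>. f ((of_bool (unsold m X D t n \<omega>), remaining_time D t k \<omega>), case_sum X D j \<omega>))"
  shows "expectation (\<lambda>\<omega>. f ((of_bool (unsold m X D t n \<omega>), remaining_time D t k \<omega>), case_sum X D j \<omega>))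
    = expectation (\<lambda>\<omega>. \<integral>x. f ((of_bool (unsold m X D t n \<omega>), remaining_time D t k \<omega>), x) \<partial>distr M borel (case_sum X D j))"
proof -
  \<comment> \<open>The state is a measurable function of the tuple of past variables: the process is
  evaluated on the tuple itself, with the coordinate projections as offers and waiting times.\<close>
  let ?A = "Inl ` {1..n} \<union> Inr ` {1..k} :: (nat + nat) set"
  let ?fam = "case_sum X D"
  let ?X = "\<lambda>i f. f (Inl i) :: real" and ?D = "\<lambda>i f. f (Inr i) :: real"
  let ?u = "\<lambda>f. (of_bool (unsold m ?X ?D t n f) :: real, remaining_time ?D t k f)"
  let ?past = "\<lambda>\<omega>. restrict (\<lambda>i. ?fam i \<omega>) ?A" and ?next = "\<lambda>\<omega>. restrict (\<lambda>i. ?fam i \<omega>) {j}"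
  have [measurable]: "Measurable.pred (PiM ?A (\<lambda>_. borel)) (unsold m ?X ?D t n)"
    using \<open>n \<le> k\<close> by (intro pred_unsold[OF m] measurable_component_singleton) auto
  have [measurable]: "remaining_time ?D t k \<in> borel_measurable (PiM ?A (\<lambda>_. borel))"
    by (intro measurable_remaining_time measurable_component_singleton) auto
  have u: "?u (?past \<omega>) = (of_bool (unsold m X D t n \<omega>), remaining_time D t k \<omega>)" for \<omega>
  proof -
    have "unsold m ?X ?D t n (?past \<omega>) = unsold m X D t n \<omega>"
      by (rule unsold_cong) (use \<open>n \<le> k\<close> in auto)
    moreover have "remaining_time ?D t k (?past \<omega>) = remaining_time D t k \<omega>"
      by (rule remaining_time_cong) auto
    ultimately show ?thesis by simp
  qed
  have ind: "indep_var (PiM ?A (\<lambda>_. borel)) ?past (PiM {j} (\<lambda>_. borel)) ?next"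
    by (rule indep_var_restrict[OF independent]) (use j in auto)
  note [measurable] = indep_var_rv2[OF ind]
  let ?f = "\<lambda>(p, x). f (?u p, x j)"
  have f_meas: "?f \<in> borel_measurable (PiM ?A (\<lambda>_. borel) \<Otimes>\<^sub>M PiM {j} (\<lambda>_. borel))"
    by measurable
  have eq: "?f (?past \<omega>, ?next \<omega>) = f ((of_bool (unsold m X D t n \<omega>), remaining_time D t k \<omega>), ?fam j \<omega>)" for \<omega>
    by (simp only: u prod.case) simp
  have law: "distr M borel (?fam j) = distr (distr M (PiM {j} (\<lambda>_. borel)) ?next) borel (\<lambda>x. x j)"
    by (subst distr_distr) (auto simp: comp_def)
  have "expectation (\<lambda>\<omega>. ?f (?past \<omega>, ?next \<omega>))
      = expectation (\<lambda>\<omega>. \<integral>x. ?f (?past \<omega>, x) \<partial>distr M (PiM {j} (\<lambda>_. borel)) ?next)"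
    by (rule expectation_indep_split[OF ind f_meas]) (unfold eq, rule int)
  also have "\<dots> = expectation (\<lambda>\<omega>. \<integral>x. f (?u (?past \<omega>), x) \<partial>distr M borel (?fam j))"
    unfolding law by (subst integral_distr) auto
  finally show ?thesis unfolding eq u .
qed

text \<open>
  If time is left after \<open>n\<close> offers, then each of \<open>n\<close> independent waiting times is at most \<open>t\<close>.
\<close>

lemma prob_time_left_le:
  assumes "t \<ge> 0"
  shows "prob {\<omega> \<in> space M. remaining_time D t n \<omega> > 0} \<le> (1 - exp (- t * lam)) ^ n"
proof (cases "n = 0")
  case False
  have [measurable]: "remaining_time D t n \<in> borel_measurable M"
    by (rule measurable_remaining_time) simp
  have [measurable]: "{\<omega> \<in> space M. D i \<omega> \<le> t} \<in> sets M" if "i \<ge> 1" for i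
    using measurable_waiting_time[OF that] by simp
  let ?J = "Inr ` {1..n} :: (nat + nat) set"
  have "prob {\<omega> \<in> space M. remaining_time D t n \<omega> > 0}
      \<le> prob (\<Inter>j\<in>?J. case_sum X D j -` {..t} \<inter> space M)"
  proof (rule finite_measure_mono_AE)
    show "AE \<omega> in M. \<omega> \<in> {\<omega> \<in> space M. remaining_time D t n \<omega> > 0} \<longrightarrow>
        \<omega> \<in> (\<Inter>j\<in>?J. case_sum X D j -` {..t} \<inter> space M)"
      using AE_waiting_time_pos
    proof eventually_elim
      case (elim \<omega>)
      then show ?case using waiting_time_less[OF \<open>t \<ge> 0\<close>, of D \<omega> n] by (auto simp: less_imp_le)
    qed
    show "(\<Inter>j\<in>?J. case_sum X D j -` {..t} \<inter> space M) \<in> events"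
      using False by (intro sets.finite_INT) (auto intro!: measurable_sets[OF measurable_waiting_time])
  qed
  also have "\<dots> = (\<Prod>j\<in>?J. prob (case_sum X D j -` {..t} \<inter> space M))"
    by (rule indep_varsD[OF independent]) (use False in auto)
  also have "\<dots> = (\<Prod>i=1..n. prob {\<omega> \<in> space M. D i \<omega> \<le> t})"
    by (subst prod.reindex) (auto intro!: prod.cong arg_cong[where f=prob])
  also have "\<dots> = (\<Prod>i=1..n. 1 - exp (- t * lam))"
    using exponential_distributedD_le[OF D_exponential _ rate_pos] \<open>t \<ge> 0\<close> by (intro prod.cong) auto
  finally show ?thesis by simp
qed simp

end

text \<open>
  A threshold policy \<open>m\<close>, a payoff \<open>g\<close> of the price and a candidate \<open>v\<close> for the expected payoff as a
  function of the time left.  The candidate is only required to be bounded and to satisfy the renewal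
  equation \<open>v_equation\<close>.  Acceptable prices lie in \<open>[a, \<infinity>)\<close>, where \<open>g\<close> is nonnegative;
  this makes the payoff collected so far increase with the number of offers, which allows monotone
  convergence at the end without an integrability bound for the sale price known in advance.
\<close>

locale threshold_policy = bidding_process +
  fixes t :: real and m g v :: "real \<Rightarrow> real" and a B :: real
  assumes t_nonneg: "t \<ge> 0"
    and m_measurable [measurable]: "m \<in> borel_measurable borel"
    and g_measurable [measurable]: "g \<in> borel_measurable borel"
    and v_measurable [measurable]: "v \<in> borel_measurable borel"
    and threshold_ge: "\<And>r. r > 0 \<Longrightarrow> a \<le> m r"
    and g_nonneg: "\<And>x. a \<le> x \<Longrightarrow> 0 \<le> g x"
    and g_offer_integrable: "integrable M (\<lambda>\<omega>. indicator {a..} (Y \<omega>) * g (Y \<omega>))"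
    and g_residual_integrable: "integrable M (\<lambda>\<omega>. g (X 0 \<omega>))"
    and v_bounded: "\<And>r. 0 \<le> r \<Longrightarrow> r \<le> t \<Longrightarrow> \<bar>v r\<bar> \<le> B"
    and v_initial: "v 0 = expectation (\<lambda>\<omega>. g (X 0 \<omega>))"
    and v_equation: "\<And>s. 0 \<le> s \<Longrightarrow> s \<le> t \<Longrightarrow>
      ((\<lambda>r. lam * exp (lam * r) * expectation (\<lambda>\<omega>. if m r \<le> Y \<omega> then g (Y \<omega>) else v r))
        has_integral (exp (lam * s) * v s - v 0)) {0..s}"
begin

text \<open>
  The expected payoff at the moment when an offer arrives with time \<open>r\<close> left, before its
  value is known.  At \<open>r = 0\<close> the deadline has passed and the offer does not count.
\<close>

definition offer_value :: "real \<Rightarrow> real" where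
  "offer_value r = (if r > 0 then expectation (\<lambda>\<omega>. if m r \<le> Y \<omega> then g (Y \<omega>) else v r) else v 0)"

lemma Y_meas [measurable]: "Y \<in> borel_measurable M" by (rule Y_measurable)
lemma X_meas [measurable]: "X i \<in> borel_measurable M"
  using X_measurable[of i] X_0_measurable by (cases "i = 0") auto

lemma offer_value_measurable [measurable]: "offer_value \<in> borel_measurable borel"
  unfolding offer_value_def by measurable

lemma B_nonneg: "B \<ge> 0"
  using v_bounded[of 0] t_nonneg by auto

text \<open>
  The bound \<open>G\<close> dominates the expected payoff of one acceptable offer, uniformly in the threshold.
\<close>

definition G :: real where "G = expectation (\<lambda>\<omega>. indicator {a..} (Y \<omega>) * g (Y \<omega>))"

lemma offer_payoff_bound:
  assumes "0 < r" "r \<le> t"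
  shows "\<bar>if m r \<le> x then g x else v r\<bar> \<le> indicator {a..} x * g x + B"
proof (cases "m r \<le> x")
  case True
  then have "a \<le> x" using threshold_ge[OF \<open>0 < r\<close>] by simp
  with True show ?thesis using g_nonneg[of x] B_nonneg by simp
next
  case False
  then show ?thesis using v_bounded[of r] assms g_nonneg[of x] by (auto simp: indicator_def)
qed

lemma offer_payoff_integrable:
  assumes "0 < r" "r \<le> t"
  shows "integrable M (\<lambda>\<omega>. if m r \<le> Y \<omega> then g (Y \<omega>) else v r)"
proof (rule Bochner_Integration.integrable_bound)
  show "integrable M (\<lambda>\<omega>. indicator {a..} (Y \<omega>) * g (Y \<omega>) + B)"
    using g_offer_integrable by simp
  show "AE \<omega> in M. norm (if m r \<le> Y \<omega> then g (Y \<omega>) else v r) \<le> norm (indicator {a..} (Y \<omega>) * g (Y \<omega>) + B)"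
    unfolding real_norm_def
    by (intro AE_I2 order_trans[OF offer_payoff_bound[OF assms] abs_ge_self])
qed measurable

lemma G_nonneg: "0 \<le> G"
  unfolding G_def by (intro Bochner_Integration.integral_nonneg) (auto simp: indicator_def g_nonneg)

lemma offer_value_bound:
  assumes "0 \<le> r" "r \<le> t"
  shows "\<bar>offer_value r\<bar> \<le> G + B"
proof (cases "r > 0")
  case True
  have "\<bar>offer_value r\<bar> \<le> expectation (\<lambda>\<omega>. \<bar>if m r \<le> Y \<omega> then g (Y \<omega>) else v r\<bar>)"
    using True by (simp add: offer_value_def integral_abs_bound)
  also have "\<dots> \<le> expectation (\<lambda>\<omega>. indicator {a..} (Y \<omega>) * g (Y \<omega>) + B)"
    using offer_payoff_integrable[OF True assms(2)] g_offer_integrable offer_payoff_bound[OF True assms(2)]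
    by (intro integral_mono) auto
  also have "\<dots> = G + B"
    using g_offer_integrable by (simp add: G_def prob_space)
  finally show ?thesis .
next
  case False
  then show ?thesis using v_bounded[of 0] t_nonneg G_nonneg by (simp add: offer_value_def)
qed

text \<open>
  This is the renewal equation read probabilistically.  If the next waiting time \<open>d\<close> is below \<open>s\<close>, the
  offer arrives with time \<open>s - d\<close> left; otherwise, with probability \<open>exp (- lam * s)\<close>, the deadline
  comes first.  The reflection \<open>r = s - d\<close> turns the exponential density into the weight of
  \<open>v_equation\<close>.
\<close>

lemma expected_offer_value:
  assumes i: "i \<ge> 1" and s: "0 \<le> s" "s \<le> t"
  shows "(\<integral>d. offer_value (max (s - d) 0) \<partial>distr M borel (D i)) = v s"
proof -
  let ?h = "\<lambda>d. offer_value (max (s - d) 0)"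
  have [measurable]: "D i \<in> borel_measurable M" using i by simp
  have Dpos: "AE \<omega> in M. 0 < D i \<omega>" using AE_waiting_time_pos by eventually_elim (use i in auto)
  have bnd: "\<bar>indicator {..s} d * ?h d\<bar> \<le> G + B" if "0 < d" for d
    using offer_value_bound[of "s - d"] that s G_nonneg B_nonneg by (auto simp: indicator_def max_def)
  have "(\<integral>d. ?h d \<partial>distr M borel (D i)) = expectation (\<lambda>\<omega>. ?h (D i \<omega>))"
    by (subst integral_distr) auto
  also have "\<dots> = expectation (\<lambda>\<omega>. indicator {..s} (D i \<omega>) * ?h (D i \<omega>) + indicator {s<..} (D i \<omega>) * v 0)"
    by (intro Bochner_Integration.integral_cong) (auto simp: indicator_def offer_value_def)
  also have "\<dots> = expectation (\<lambda>\<omega>. indicator {..s} (D i \<omega>) * ?h (D i \<omega>)) + expectation (\<lambda>\<omega>. indicator {s<..} (D i \<omega>) * v 0)"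
  proof (rule Bochner_Integration.integral_add)
    show "integrable M (\<lambda>\<omega>. indicator {..s} (D i \<omega>) * ?h (D i \<omega>))"
      by (rule integrable_const_bound[of _ "G + B"]) (use Dpos bnd in auto)
    show "integrable M (\<lambda>\<omega>. indicator {s<..} (D i \<omega>) * v 0)"
      by (rule integrable_const_bound[of _ "\<bar>v 0\<bar>"]) (auto simp: indicator_def)
  qed
  also have "expectation (\<lambda>\<omega>. indicator {s<..} (D i \<omega>) * v 0) = exp (- (lam * s)) * v 0"
  proof -
    have "expectation (\<lambda>\<omega>. indicator {s<..} (D i \<omega>) * v 0)
        = expectation (indicator {\<omega> \<in> space M. s < D i \<omega>}) * v 0"
      by (subst integral_mult_left_zero[symmetric])
        (auto intro!: Bochner_Integration.integral_cong simp: indicator_def)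
    also have "expectation (indicator {\<omega> \<in> space M. s < D i \<omega>}) = prob {\<omega> \<in> space M. s < D i \<omega>}"
      by simp
    also have "\<dots> = exp (- (lam * s))"
      using exponential_distributedD_gt[OF D_exponential[OF i] s(1) rate_pos] by (simp add: mult.commute)
    finally show ?thesis .
  qed
  also have "expectation (\<lambda>\<omega>. indicator {..s} (D i \<omega>) * ?h (D i \<omega>))
      = (\<integral>d. exponential_density lam d * (indicator {..s} d * ?h d) \<partial>lborel)"
    by (rule distributed_integral[OF D_exponential[OF i], symmetric])
       (use rate_pos in \<open>auto simp: exponential_density_def\<close>)
  also have "\<dots> = (\<integral>d. indicator {0..s} d * (lam * exp (- lam * d) * ?h d) \<partial>lborel)"
    by (intro Bochner_Integration.integral_cong)
       (auto simp: exponential_density_def indicator_def mult.commute)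
  also have "\<dots> = (\<integral>r. indicator {0..s} r * (lam * exp (- lam * (s - r)) * offer_value r) \<partial>lborel)"
    by (subst lborel_integral_real_affine[of "-1" _ s])
       (auto intro!: Bochner_Integration.integral_cong simp: indicator_def)
  also have "\<dots> = exp (- (lam * s)) * (\<integral>r. indicator {0..s} r * (lam * exp (lam * r) * offer_value r) \<partial>lborel)"
    by (subst integral_mult_right_zero[symmetric], intro Bochner_Integration.integral_cong)
       (auto simp: indicator_def algebra_simps exp_diff exp_minus field_simps)
  also have "(\<integral>r. indicator {0..s} r * (lam * exp (lam * r) * offer_value r) \<partial>lborel) = exp (lam * s) * v s - v 0"
  proof -
    let ?k = "\<lambda>r. lam * exp (lam * r) * offer_value r"
    have si: "set_integrable lborel {0..s} ?k"
    proof (rule set_integrable_bound[of _ _ "\<lambda>_. lam * exp (lam * s) * (G + B)"])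
      show "set_integrable lborel {0..s} (\<lambda>_. lam * exp (lam * s) * (G + B))"
        by (intro borel_integrable_atLeastAtMost') auto
      show "set_borel_measurable lborel {0..s} ?k" by (simp add: set_borel_measurable_def)
      have "\<bar>?k r\<bar> \<le> lam * exp (lam * s) * (G + B)" if "0 \<le> r" "r \<le> s" for r
        using offer_value_bound[of r] that s rate_pos G_nonneg B_nonneg
        by (auto simp: abs_mult intro!: mult_mono)
      then show "AE x in lborel. x \<in> {0..s} \<longrightarrow> norm (?k x) \<le> norm (lam * exp (lam * s) * (G + B))"
        by (intro AE_I2) (auto intro: order_trans[OF _ abs_ge_self])
    qed
    have "(\<integral>r. indicator {0..s} r * ?k r \<partial>lborel) = integral {0..s} ?k"
      using set_borel_integral_eq_integral(2)[OF si] by (simp add: set_lebesgue_integral_def)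
    also have "(?k has_integral (exp (lam * s) * v s - v 0)) {0..s}"
      by (rule has_integral_spike_finite[OF _ _ v_equation[OF s], of "{0}"])
         (auto simp: offer_value_def)
    then have "integral {0..s} ?k = exp (lam * s) * v s - v 0" by (rule integral_unique)
    finally show ?thesis .
  qed
  finally show ?thesis by (simp add: algebra_simps exp_minus field_simps)
qed

definition still_unsold :: "nat \<Rightarrow> 'a \<Rightarrow> real" where "still_unsold n \<omega> = of_bool (unsold m X D t n \<omega>)"

abbreviation "rest n \<equiv> remaining_time D t n"
abbreviation "payoff r x \<equiv> (if r > 0 \<and> m r \<le> x then g x else v r)"

lemma rest_measurable [measurable]: "rest n \<in> borel_measurable M"
  by (rule measurable_remaining_time) simp
lemma still_unsold_measurable [measurable]: "still_unsold n \<in> borel_measurable M"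
  using pred_unsold[OF m_measurable, of n D M X t] unfolding still_unsold_def[abs_def] by measurable

lemma AE_rest: "AE \<omega> in M. \<forall>n. 0 \<le> rest n \<omega> \<and> rest n \<omega> \<le> t"
  using AE_waiting_time_pos
proof eventually_elim
  case (elim \<omega>)
  then show ?case
    by (intro allI conjI remaining_time_nonneg remaining_time_le t_nonneg) (auto intro: less_imp_le)
qed

lemma still_unsold_cases: "still_unsold n \<omega> = 0 \<or> still_unsold n \<omega> = 1"
  by (auto simp: still_unsold_def)

lemma still_unsold_mult_abs_le: "\<bar>still_unsold n \<omega> * x\<bar> \<le> \<bar>x\<bar>"
  using still_unsold_cases[of n \<omega>] by auto

lemma g_X_integrable: "i \<ge> 1 \<Longrightarrow> integrable M (\<lambda>\<omega>. indicator {a..} (X i \<omega>) * g (X i \<omega>))"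
proof -
  assume i: "i \<ge> 1"
  have "integrable (distr M borel Y) (\<lambda>x. indicator {a..} x * g x)"
    by (subst integrable_distr_eq) (use g_offer_integrable in auto)
  then have "integrable (distr M borel (X i)) (\<lambda>x. indicator {a..} x * g x)"
    by (simp add: offer_law[OF i])
  then show ?thesis by (subst (asm) integrable_distr_eq) auto
qed

lemma payoff_integrable: "integrable M (\<lambda>\<omega>. still_unsold n \<omega> * payoff (rest (Suc n) \<omega>) (X (Suc n) \<omega>))"
proof (rule Bochner_Integration.integrable_bound)
  show "integrable M (\<lambda>\<omega>. indicator {a..} (X (Suc n) \<omega>) * g (X (Suc n) \<omega>) + B)"
    using g_X_integrable[of "Suc n"] by simp
  show "AE \<omega> in M. norm (still_unsold n \<omega> * payoff (rest (Suc n) \<omega>) (X (Suc n) \<omega>))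
      \<le> norm (indicator {a..} (X (Suc n) \<omega>) * g (X (Suc n) \<omega>) + B)"
    using AE_rest
  proof eventually_elim
    case (elim \<omega>)
    let ?r = "rest (Suc n) \<omega>" and ?x = "X (Suc n) \<omega>"
    have r: "0 \<le> ?r" "?r \<le> t" using elim by blast+
    have "\<bar>still_unsold n \<omega> * payoff ?r ?x\<bar> \<le> \<bar>payoff ?r ?x\<bar>"
      using still_unsold_cases[of n \<omega>] by auto
    also have "\<dots> \<le> indicator {a..} ?x * g ?x + B"
    proof (cases "?r > 0")
      case True
      then show ?thesis using offer_payoff_bound[OF True r(2), of ?x] by (simp del: remaining_time.simps)
    next
      case False
      then have "?r = 0" using r(1) by linarith
      then show ?thesis using v_bounded[of 0] t_nonneg g_nonneg[of ?x]
        by (auto simp: indicator_def simp del: remaining_time.simps)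
    qed
    finally show ?case by (simp del: remaining_time.simps)
  qed
qed (simp del: remaining_time.simps)

text \<open>
  The invariance behind the theorem: an unsold object with time \<open>r\<close> left is worth \<open>v r\<close>, both now
  and on average after one more offer.  The offer is averaged out first, which yields
  \<open>offer_value\<close>, then the waiting time, by \<open>expected_offer_value\<close>.
\<close>

lemma one_step:
  "expectation (\<lambda>\<omega>. still_unsold n \<omega> * payoff (rest (Suc n) \<omega>) (X (Suc n) \<omega>)) = expectation (\<lambda>\<omega>. still_unsold n \<omega> * v (rest n \<omega>))"
proof -
  let ?f = "\<lambda>z :: (real \<times> real) \<times> real. fst (fst z) * payoff (snd (fst z)) (snd z)"
  let ?U = "\<lambda>k \<omega>. (of_bool (unsold m X D t n \<omega>) :: real, rest k \<omega>)"
  let ?o = "\<lambda>z :: (real \<times> real) \<times> real. fst (fst z) * offer_value (max (snd (fst z) - snd z) 0)"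
  have [measurable]: "?f \<in> borel_measurable ((borel \<Otimes>\<^sub>M borel) \<Otimes>\<^sub>M borel)" by measurable
  have "expectation (\<lambda>\<omega>. ?f (?U (Suc n) \<omega>, X (Suc n) \<omega>))
      = expectation (\<lambda>\<omega>. \<integral>x. ?f (?U (Suc n) \<omega>, x) \<partial>distr M borel (X (Suc n)))"
    using expectation_past_split[OF m_measurable, of n "Suc n" "Inl (Suc n)" ?f t] payoff_integrable[of n]
    by (simp add: still_unsold_def image_iff Plus_def del: remaining_time.simps cong: if_cong)
  also have "\<dots> = expectation (\<lambda>\<omega>. still_unsold n \<omega> * offer_value (rest (Suc n) \<omega>))"
  proof (intro Bochner_Integration.integral_cong refl)
    fix \<omega> assume "\<omega> \<in> space M"
    have r: "0 \<le> rest (Suc n) \<omega>" by (rule remaining_time_nonneg[OF t_nonneg])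
    define r where "r = rest (Suc n) \<omega>"
    have "(\<integral>x. ?f (?U (Suc n) \<omega>, x) \<partial>distr M borel (X (Suc n)))
      = expectation (\<lambda>\<omega>'. still_unsold n \<omega> * payoff r (Y \<omega>'))"
      by (simp add: offer_law integral_distr still_unsold_def r_def del: remaining_time.simps of_bool_eq_iff cong: if_cong)
    also have "\<dots> = still_unsold n \<omega> * offer_value r"
      using r by (cases "r > 0") (auto simp: offer_value_def r_def[symmetric] prob_space simp del: remaining_time.simps)
    finally show "(\<integral>x. ?f (?U (Suc n) \<omega>, x) \<partial>distr M borel (X (Suc n))) = still_unsold n \<omega> * offer_value (rest (Suc n) \<omega>)"
      by (simp add: r_def)
  qed
  also have "\<dots> = expectation (\<lambda>\<omega>. ?o (?U n \<omega>, D (Suc n) \<omega>))"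
    by (simp add: still_unsold_def)
  also have "\<dots> = expectation (\<lambda>\<omega>. \<integral>d. ?o (?U n \<omega>, d) \<partial>distr M borel (D (Suc n)))"
  proof -
    have "integrable M (\<lambda>\<omega>. still_unsold n \<omega> * offer_value (rest (Suc n) \<omega>))"
    proof (rule integrable_const_bound)
      show "AE \<omega> in M. norm (still_unsold n \<omega> * offer_value (rest (Suc n) \<omega>)) \<le> G + B"
        using AE_rest
      proof eventually_elim
        case (elim \<omega>)
        then have "\<bar>offer_value (rest (Suc n) \<omega>)\<bar> \<le> G + B" by (intro offer_value_bound) blast+
        then show ?case using still_unsold_cases[of n \<omega>] G_nonneg B_nonneg by auto
      qed
    qed measurable
    then show ?thesis
      using expectation_past_split[OF m_measurable, of n n "Inr (Suc n)" ?o t]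
      by (simp add: still_unsold_def image_iff Plus_def)
  qed
  also have "\<dots> = expectation (\<lambda>\<omega>. still_unsold n \<omega> * v (rest n \<omega>))"
  proof (rule integral_cong_AE)
    show "AE \<omega> in M. (\<integral>d. ?o (?U n \<omega>, d) \<partial>distr M borel (D (Suc n)))
       = still_unsold n \<omega> * v (rest n \<omega>)"
      using AE_rest
    proof eventually_elim
      case (elim \<omega>)
      then show ?case using expected_offer_value[of "Suc n" "rest n \<omega>"] by (simp add: still_unsold_def)
    qed
    have "prob_space (distr M borel (D (Suc n)))" by (rule prob_space_distr) simp
    then interpret DD: prob_space "distr M borel (D (Suc n))" .
    have [measurable]: "Measurable.pred M (unsold m X D t n)"
      by (rule pred_unsold) auto
    show "(\<lambda>\<omega>. \<integral>d. ?o (?U n \<omega>, d) \<partial>distr M borel (D (Suc n))) \<in> borel_measurable M"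
      by measurable
  qed measurable
  finally show ?thesis by (simp add: still_unsold_def del: remaining_time.simps cong: if_cong)
qed

definition revenue :: "nat \<Rightarrow> 'a \<Rightarrow> real" where
  "revenue n \<omega> = (\<Sum>i<n. still_unsold i \<omega> * of_bool (accepted m X D t (Suc i) \<omega>) * g (X (Suc i) \<omega>))"

lemma accepted_measurable [measurable]: "Measurable.pred M (accepted m X D t i)"
  by (rule pred_accepted) auto

lemma accepted_ge: "accepted m X D t i \<omega> \<Longrightarrow> a \<le> X i \<omega>"
  using threshold_ge by (auto simp: accepted_def intro: order_trans)

lemma revenue_term_nonneg: "0 \<le> still_unsold i \<omega> * of_bool (accepted m X D t (Suc i) \<omega>) * g (X (Suc i) \<omega>)"
  using accepted_ge[of "Suc i" \<omega>] g_nonneg still_unsold_cases[of i \<omega>] by auto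

lemma revenue_term_integrable:
  "integrable M (\<lambda>\<omega>. still_unsold i \<omega> * of_bool (accepted m X D t (Suc i) \<omega>) * g (X (Suc i) \<omega>))"
proof (rule Bochner_Integration.integrable_bound[OF g_X_integrable[of "Suc i"]])
  show "AE \<omega> in M. norm (still_unsold i \<omega> * of_bool (accepted m X D t (Suc i) \<omega>) * g (X (Suc i) \<omega>))
      \<le> norm (indicator {a..} (X (Suc i) \<omega>) * g (X (Suc i) \<omega>))"
    using accepted_ge[of "Suc i"] by (auto simp: still_unsold_def indicator_def)
qed simp_all

lemma still_unsold_value_integrable: "integrable M (\<lambda>\<omega>. still_unsold n \<omega> * v (rest n \<omega>))"
proof (rule integrable_const_bound)
  show "AE \<omega> in M. norm (still_unsold n \<omega> * v (rest n \<omega>)) \<le> B"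
    using AE_rest
  proof eventually_elim
    case (elim \<omega>)
    then show ?case using v_bounded[of "rest n \<omega>"] still_unsold_cases[of n \<omega>] B_nonneg by auto
  qed
qed measurable

text \<open>
  By \<open>one_step\<close>, \<open>revenue n + still_unsold n * v (rest n)\<close> has constant expectation; at \<open>n = 0\<close> it equals \<open>v t\<close>.
\<close>

lemma expected_revenue:
  "expectation (revenue n) = v t - expectation (\<lambda>\<omega>. still_unsold n \<omega> * v (rest n \<omega>))"
proof (induction n)
  case 0
  then show ?case by (simp add: revenue_def still_unsold_def prob_space)
next
  case (Suc n)
  let ?T = "\<lambda>\<omega>. still_unsold n \<omega> * of_bool (accepted m X D t (Suc n) \<omega>) * g (X (Suc n) \<omega>)"
  have [simp]: "integrable M (revenue n)"
    unfolding revenue_def by (intro Bochner_Integration.integrable_sum revenue_term_integrable)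
  have "expectation (\<lambda>\<omega>. still_unsold n \<omega> * payoff (rest (Suc n) \<omega>) (X (Suc n) \<omega>))
      = expectation (\<lambda>\<omega>. ?T \<omega> + still_unsold (Suc n) \<omega> * v (rest (Suc n) \<omega>))"
    by (intro Bochner_Integration.integral_cong)
       (auto simp: still_unsold_def unsold_Suc accepted_def simp del: remaining_time.simps)
  also have "\<dots> = expectation ?T + expectation (\<lambda>\<omega>. still_unsold (Suc n) \<omega> * v (rest (Suc n) \<omega>))"
    by (rule Bochner_Integration.integral_add[OF revenue_term_integrable still_unsold_value_integrable])
  finally have "expectation ?T = expectation (\<lambda>\<omega>. still_unsold n \<omega> * v (rest n \<omega>)) - expectation (\<lambda>\<omega>. still_unsold (Suc n) \<omega> * v (rest (Suc n) \<omega>))"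
    unfolding one_step by linarith
  moreover have "revenue (Suc n) = (\<lambda>\<omega>. revenue n \<omega> + ?T \<omega>)"
    by (simp add: revenue_def fun_eq_iff)
  ultimately show ?case using Suc by (simp add: Bochner_Integration.integral_add revenue_term_integrable)
qed

text \<open>
  The difference vanishes unless time is left, an event whose probability decays geometrically.
\<close>

lemma time_runs_out: "(\<lambda>n. expectation (\<lambda>\<omega>. still_unsold n \<omega> * (v (rest n \<omega>) - v 0))) \<longlonglongrightarrow> 0"
proof (rule tendsto_0_le)
  have "(\<lambda>n. (1 - exp (- t * lam)) ^ n) \<longlonglongrightarrow> 0"
    by (rule LIMSEQ_power_zero) (use t_nonneg rate_pos in auto)
  then show "(\<lambda>n. (2 * B) * (1 - exp (- t * lam)) ^ n) \<longlonglongrightarrow> 0"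
    by (rule tendsto_mult_right_zero)
  have "\<bar>expectation (\<lambda>\<omega>. still_unsold n \<omega> * (v (rest n \<omega>) - v 0))\<bar> \<le> 2 * B * (1 - exp (- t * lam)) ^ n" for n
  proof -
    have "\<bar>expectation (\<lambda>\<omega>. still_unsold n \<omega> * (v (rest n \<omega>) - v 0))\<bar>
        \<le> expectation (\<lambda>\<omega>. \<bar>still_unsold n \<omega> * (v (rest n \<omega>) - v 0)\<bar>)"
      by (rule integral_abs_bound)
    also have "\<dots> \<le> expectation (\<lambda>\<omega>. 2 * B * indicator {\<omega> \<in> space M. rest n \<omega> > 0} \<omega>)"
    proof (rule integral_mono_AE')
      show "AE \<omega> in M. \<bar>still_unsold n \<omega> * (v (rest n \<omega>) - v 0)\<bar> \<le> 2 * B * indicator {\<omega> \<in> space M. rest n \<omega> > 0} \<omega>"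
        using AE_rest AE_space
      proof eventually_elim
        case (elim \<omega>)
        have "\<bar>still_unsold n \<omega> * (v (rest n \<omega>) - v 0)\<bar> \<le> \<bar>v (rest n \<omega>) - v 0\<bar>"
          using still_unsold_cases[of n \<omega>] by auto
        also have "\<dots> \<le> 2 * B * indicator {\<omega> \<in> space M. rest n \<omega> > 0} \<omega>"
        proof (cases "rest n \<omega> > 0")
          case True
          then show ?thesis using v_bounded[of "rest n \<omega>"] v_bounded[of 0] elim t_nonneg
            by (auto simp: indicator_def)
        next
          case False
          then have "rest n \<omega> = 0" using elim by (meson antisym not_le)
          then show ?thesis using B_nonneg by simp
        qed
        finally show ?case .
      qed
      show "integrable M (\<lambda>\<omega>. 2 * B * indicator {\<omega> \<in> space M. rest n \<omega> > 0} \<omega>)"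
        by (intro integrable_mult_right integrable_real_indicator) (auto simp: less_top[symmetric])
    qed (use B_nonneg in \<open>auto simp: indicator_def\<close>)
    also have "\<dots> = 2 * B * prob {\<omega> \<in> space M. rest n \<omega> > 0}" by simp
    also have "\<dots> \<le> 2 * B * (1 - exp (- t * lam)) ^ n"
      using prob_time_left_le[OF t_nonneg, of n] B_nonneg by (intro mult_left_mono) auto
    finally show ?thesis .
  qed
  then show "\<forall>\<^sub>F n in sequentially. norm (expectation (\<lambda>\<omega>. still_unsold n \<omega> * (v (rest n \<omega>) - v 0))) \<le> norm (2 * B * (1 - exp (- t * lam)) ^ n) * 1"
    by (intro always_eventually allI) (auto intro: order_trans[OF _ abs_ge_self])
qed

lemma residual_indep:
  "expectation (\<lambda>\<omega>. still_unsold n \<omega> * g (X 0 \<omega>)) = expectation (still_unsold n) * v 0"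
proof -
  have "integrable M (\<lambda>\<omega>. still_unsold n \<omega> * g (X 0 \<omega>))"
    by (rule Bochner_Integration.integrable_bound[OF g_residual_integrable])
       (simp_all add: still_unsold_mult_abs_le del: abs_mult)
  moreover have "(\<lambda>z :: (real \<times> real) \<times> real. fst (fst z) * g (snd z)) \<in> borel_measurable ((borel \<Otimes>\<^sub>M borel) \<Otimes>\<^sub>M borel)"
    by measurable
  ultimately have "expectation (\<lambda>\<omega>. (\<lambda>z :: (real \<times> real) \<times> real. fst (fst z) * g (snd z)) ((of_bool (unsold m X D t n \<omega>) :: real, rest n \<omega>), X 0 \<omega>))
     = expectation (\<lambda>\<omega>. \<integral>x. (\<lambda>z :: (real \<times> real) \<times> real. fst (fst z) * g (snd z)) ((of_bool (unsold m X D t n \<omega>) :: real, rest n \<omega>), x) \<partial>distr M borel (X 0))"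
    using expectation_past_split[OF m_measurable, of n n "Inl 0" "\<lambda>z :: (real \<times> real) \<times> real. fst (fst z) * g (snd z)" t]
    by (simp add: still_unsold_def image_iff Plus_def)
  then show ?thesis by (simp add: still_unsold_def[abs_def] integral_distr v_initial)
qed

text \<open>
  The price payoff splits into the limit of \<open>revenue n\<close> if there is a sale, and \<open>g (X 0)\<close> otherwise.
  The expectations of \<open>revenue n\<close> converge by the three preceding lemmas, so monotone convergence
  yields the integrability and the value of the first part; the second part is dominated.
\<close>

theorem expectation_sale_price:
  shows "integrable M (\<lambda>\<omega>. g (sale_price m X D t \<omega>))"
    and "expectation (\<lambda>\<omega>. g (sale_price m X D t \<omega>)) = v t"
proof -
  let ?sold = "\<lambda>\<omega>. \<exists>i. accepted m X D t i \<omega>"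
  let ?R = "\<lambda>\<omega>. if ?sold \<omega> then g (X (LEAST i. accepted m X D t i \<omega>) \<omega>) else 0"
  let ?N = "\<lambda>\<omega>. if ?sold \<omega> then 0 else g (X 0 \<omega>)"
  have rev_lim: "(\<lambda>n. revenue n \<omega>) \<longlonglongrightarrow> ?R \<omega>" for \<omega>
  proof (cases "?sold \<omega>")
    case True
    define k where "k = (LEAST i. accepted m X D t i \<omega>)"
    have acc: "accepted m X D t k \<omega>" unfolding k_def using True by (rule LeastI_ex)
    then obtain j where j: "k = Suc j" by (cases k) (auto simp: accepted_def)
    have "still_unsold i \<omega> * of_bool (accepted m X D t (Suc i) \<omega>) * g (X (Suc i) \<omega>)
        = (if i = j then g (X k \<omega>) else 0)" for i
      using unsold_accepted_iff_first[of m X D t i \<omega>] True j by (auto simp: still_unsold_def k_def)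
    then have "revenue n \<omega> = ?R \<omega>" if "n > j" for n
      using that True by (simp add: revenue_def k_def[symmetric])
    then show ?thesis by (intro tendsto_eventually eventually_sequentiallyI[of "Suc j"]) auto
  next
    case False
    then show ?thesis by (simp add: revenue_def)
  qed
  have still_unsold_lim: "(\<lambda>n. still_unsold n \<omega> * g (X 0 \<omega>)) \<longlonglongrightarrow> ?N \<omega>" for \<omega>
  proof (cases "?sold \<omega>")
    case True
    then obtain k where "accepted m X D t k \<omega>" by auto
    then have "still_unsold n \<omega> = 0" if "n \<ge> k" for n using that by (auto simp: still_unsold_def unsold_def)
    then show ?thesis using True by (intro tendsto_eventually eventually_sequentiallyI[of k]) auto
  next
    case False
    then show ?thesis by (simp add: still_unsold_def unsold_def)
  qed
  have [measurable]: "?R \<in> borel_measurable M" "?N \<in> borel_measurable M"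
  proof -
    show "?R \<in> borel_measurable M"
      by (rule borel_measurable_LIMSEQ_real[OF rev_lim]) (simp add: revenue_def[abs_def])
    show "?N \<in> borel_measurable M"
      by (rule borel_measurable_LIMSEQ_real[OF still_unsold_lim]) simp
  qed
  have N_int: "integrable M ?N" and N_lim: "(\<lambda>n. expectation (\<lambda>\<omega>. still_unsold n \<omega> * g (X 0 \<omega>))) \<longlonglongrightarrow> expectation ?N"
  proof -
    have b: "AE \<omega> in M. norm (still_unsold n \<omega> * g (X 0 \<omega>)) \<le> \<bar>g (X 0 \<omega>)\<bar>" for n
      by (intro AE_I2) (simp only: real_norm_def still_unsold_mult_abs_le)
    have ib: "integrable M (\<lambda>\<omega>. \<bar>g (X 0 \<omega>)\<bar>)" using g_residual_integrable by simp
    show "integrable M ?N"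
      by (rule Bochner_Integration.integrable_bound[OF g_residual_integrable]) auto
    show "(\<lambda>n. expectation (\<lambda>\<omega>. still_unsold n \<omega> * g (X 0 \<omega>))) \<longlonglongrightarrow> expectation ?N"
      by (rule integral_dominated_convergence[OF _ _ ib _ b]) (use still_unsold_lim in auto)
  qed
  have ER: "expectation (revenue n) = v t - expectation (\<lambda>\<omega>. still_unsold n \<omega> * (v (rest n \<omega>) - v 0)) - expectation (\<lambda>\<omega>. still_unsold n \<omega> * g (X 0 \<omega>))" for n
  proof -
    have "integrable M (still_unsold n)"
      by (rule integrable_const_bound[of _ 1]) (auto simp: still_unsold_def)
    then have "expectation (\<lambda>\<omega>. still_unsold n \<omega> * (v (rest n \<omega>) - v 0)) = expectation (\<lambda>\<omega>. still_unsold n \<omega> * v (rest n \<omega>)) - expectation (still_unsold n) * v 0"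
      by (simp add: right_diff_distrib still_unsold_value_integrable)
    then show ?thesis by (simp add: expected_revenue residual_indep)
  qed
  have ER_lim: "(\<lambda>n. expectation (revenue n)) \<longlonglongrightarrow> v t - 0 - expectation ?N"
    unfolding ER by (intro tendsto_intros time_runs_out N_lim)
  have "has_bochner_integral M ?R (v t - 0 - expectation ?N)"
  proof (rule has_bochner_integral_monotone_convergence[OF _ _ _ ER_lim])
    show "integrable M (revenue n)" for n
      unfolding revenue_def by (intro Bochner_Integration.integrable_sum revenue_term_integrable)
    show "AE \<omega> in M. mono (\<lambda>n. revenue n \<omega>)"
      by (intro AE_I2 incseq_SucI) (use revenue_term_nonneg in \<open>simp add: revenue_def\<close>)
  qed (use rev_lim in auto)
  then have R: "integrable M ?R" "expectation ?R = v t - expectation ?N"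
    by (auto simp: has_bochner_integral_iff)
  have eq: "g (sale_price m X D t \<omega>) = ?R \<omega> + ?N \<omega>" for \<omega>
    by (simp add: sale_price_def)
  show "integrable M (\<lambda>\<omega>. g (sale_price m X D t \<omega>))"
    unfolding eq by (intro Bochner_Integration.integrable_add R N_int)
  show "expectation (\<lambda>\<omega>. g (sale_price m X D t \<omega>)) = v t"
    unfolding eq using R N_int by (simp add: Bochner_Integration.integral_add)
qed

end

section \<open>Analysis of the offer distribution and of the policy\<close>

lemma interval_integral_has_real_derivative:
  fixes h :: "real \<Rightarrow> real"
  assumes "a < x" "x < b" "a \<le> m" "m \<le> b" "continuous_on {a..b} h"
  shows "((\<lambda>x. LBINT u=ereal m..ereal x. h u) has_real_derivative h x) (at x)"
proof -
  have "((\<lambda>x. LBINT u=ereal m..ereal x. h u) has_vector_derivative h x) (at x within {a..b})"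
    using assms by (intro interval_integral_FTC2) auto
  then have "((\<lambda>x. LBINT u=ereal m..ereal x. h u) has_vector_derivative h x) (at x within {a<..<b})"
    by (rule has_vector_derivative_within_subset) auto
  then show ?thesis
    using assms by (simp add: has_real_derivative_iff_has_vector_derivative at_within_open[of x "{a<..<b}"])
qed

text \<open>
  The integration over \<open>x\<close> in the proof of \<open>tail_moment\<close>, for a fixed value \<open>y\<close> of the offer.
\<close>

lemma nn_integral_truncated_power:
  fixes w y :: real
  shows "(\<integral>\<^sup>+ x. ennreal (indicator {w<..} x * ((y - x) ^ n * indicator {..<y} x)) \<partial>lborel)
    = ennreal (max (y - w) 0 ^ Suc n / Suc n)"
proof (cases "w < y")
  case True
  have "(\<integral>\<^sup>+ x. ennreal (indicator {w<..} x * ((y - x) ^ n * indicator {..<y} x)) \<partial>lborel)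
      = (\<integral>\<^sup>+ x. ennreal ((y - x) ^ n) * indicator {w..y} x \<partial>lborel)"
  proof (rule nn_integral_cong_AE)
    show "AE x in lborel. ennreal (indicator {w<..} x * ((y - x) ^ n * indicator {..<y} x))
        = ennreal ((y - x) ^ n) * indicator {w..y} x"
      using AE_lborel_singleton[of w] AE_lborel_singleton[of y]
      by eventually_elim (auto simp: indicator_def)
  qed
  also have "\<dots> = ennreal (- ((y - y) ^ Suc n / Suc n) - - ((y - w) ^ Suc n / Suc n))"
  proof (rule nn_integral_FTC_Icc[where F="\<lambda>x. - ((y - x) ^ Suc n / Suc n)"])
    fix x
    have "((\<lambda>x. - ((y - x) ^ Suc n / Suc n)) has_real_derivative - ((1 + of_nat n) * (-1 * (y - x) ^ n) / Suc n)) (at x)"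
      by (intro DERIV_minus DERIV_cdivide DERIV_power_Suc) (auto intro!: derivative_eq_intros)
    then show "((\<lambda>x. - ((y - x) ^ Suc n / Suc n)) has_real_derivative (y - x) ^ n) (at x)"
      by simp
  qed (use True in auto)
  finally show ?thesis using True by simp
next
  case False
  then have "indicator {w<..} x * ((y - x) ^ n * indicator {..<y} x) = 0" for x :: real
    by (cases "w < x"; cases "x < y") auto
  then have "(\<integral>\<^sup>+ x. ennreal (indicator {w<..} x * ((y - x) ^ n * indicator {..<y} x)) \<partial>lborel) = 0"
    by (simp only: ennreal_0 nn_integral_const mult_zero_left)
  moreover have "max (y - w) 0 = 0" using False by simp
  ultimately show ?thesis by (simp only:) simp
qed

text \<open>
  Averaging an integral identity over the sample space: Fubini's theorem in a form that takes the
  pathwise identity as a gauge integral, as delivered by the fundamental theorem of calculus with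
  exceptional points, and returns the averaged identity in the same form.
\<close>

lemma (in prob_space) expectation_has_integral:
  fixes f :: "real \<Rightarrow> 'a \<Rightarrow> real"
  assumes f: "case_prod f \<in> borel_measurable (lborel \<Otimes>\<^sub>M M)"
    and Z: "integrable M Z" and bound: "\<And>r \<omega>. a \<le> r \<Longrightarrow> r \<le> b \<Longrightarrow> \<omega> \<in> space M \<Longrightarrow> \<bar>f r \<omega>\<bar> \<le> Z \<omega>"
    and int: "\<And>\<omega>. \<omega> \<in> space M \<Longrightarrow> ((\<lambda>r. f r \<omega>) has_integral H \<omega>) {a..b}"
  shows "((\<lambda>r. expectation (f r)) has_integral expectation H) {a..b}"
proof -
  interpret P: pair_sigma_finite lborel M by unfold_locales
  have [measurable]: "Z \<in> borel_measurable M" using Z by auto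
  note [measurable] = f
  let ?h = "\<lambda>r \<omega>. indicator {a..b} r * f r \<omega>"
  have dom: "integrable (lborel \<Otimes>\<^sub>M M) (\<lambda>(r, \<omega>). indicator {a..b} r * \<bar>Z \<omega>\<bar>)"
  proof (rule P.Fubini_integrable)
    have "integrable lborel (\<lambda>r. indicator {a..b} r * expectation (\<lambda>\<omega>. \<bar>Z \<omega>\<bar>))"
      by (intro integrable_mult_left integrable_real_indicator) (auto simp: emeasure_lborel_Icc_eq)
    then show "integrable lborel (\<lambda>r. expectation (\<lambda>\<omega>. norm (case (r, \<omega>) of (r, \<omega>) \<Rightarrow> indicator {a..b} r * \<bar>Z \<omega>\<bar>)))"
      by (simp add: abs_mult)
  qed (use Z in auto)
  have h: "integrable (lborel \<Otimes>\<^sub>M M) (case_prod ?h)"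
    by (rule Bochner_Integration.integrable_bound[OF dom])
       (use bound in \<open>auto simp: space_pair_measure indicator_def intro!: AE_I2 order_trans[OF _ abs_ge_self]\<close>)
  have E: "(\<integral>\<omega>. ?h r \<omega> \<partial>M) = indicator {a..b} r *\<^sub>R expectation (f r)" for r
    by simp
  have si: "set_integrable lborel {a..b} (\<lambda>r. expectation (f r))"
    using P.integrable_fst[OF h] unfolding E set_integrable_def .
  have inner: "(\<integral>r. ?h r \<omega> \<partial>lborel) = H \<omega>" if \<omega>: "\<omega> \<in> space M" for \<omega>
  proof -
    have [measurable]: "(\<lambda>r. f r \<omega>) \<in> borel_measurable lborel" using \<omega> f by measurable
    have "set_integrable lborel {a..b} (\<lambda>r. f r \<omega>)"
    proof (rule set_integrable_bound[of _ _ "\<lambda>_. Z \<omega>"])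
      show "set_integrable lborel {a..b} (\<lambda>_. Z \<omega>)"
        by (intro borel_integrable_atLeastAtMost') auto
      show "set_borel_measurable lborel {a..b} (\<lambda>r. f r \<omega>)" by (simp add: set_borel_measurable_def)
      show "AE r in lborel. r \<in> {a..b} \<longrightarrow> norm (f r \<omega>) \<le> norm (Z \<omega>)"
        using bound[OF _ _ \<omega>] by (auto intro!: AE_I2 order_trans[OF _ abs_ge_self])
    qed
    then have "(LINT r:{a..b}|lborel. f r \<omega>) = integral {a..b} (\<lambda>r. f r \<omega>)"
      by (rule set_borel_integral_eq_integral)
    also have "\<dots> = H \<omega>" by (rule integral_unique[OF int[OF \<omega>]])
    finally show ?thesis by (simp add: set_lebesgue_integral_def)
  qed
  have "integral {a..b} (\<lambda>r. expectation (f r)) = (LINT r:{a..b}|lborel. expectation (f r))"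
    by (rule set_borel_integral_eq_integral(2)[OF si, symmetric])
  also have "\<dots> = (\<integral>r. (\<integral>\<omega>. ?h r \<omega> \<partial>M) \<partial>lborel)"
    unfolding E set_lebesgue_integral_def ..
  also have "\<dots> = (\<integral>\<omega>. (\<integral>r. ?h r \<omega> \<partial>lborel) \<partial>M)"
    by (rule P.Fubini_integral[OF h, symmetric])
  also have "\<dots> = expectation H"
    by (rule Bochner_Integration.integral_cong[OF refl inner])
  finally show ?thesis
    using set_borel_integral_eq_integral(1)[OF si] by (metis integrable_integral)
qed

locale offer_distribution = prob_space M for M :: "'a measure" +
  fixes Y :: "'a \<Rightarrow> real" and F :: "real \<Rightarrow> real"
  assumes offer_measurable [measurable]: "random_variable borel Y"
    and offer_cdf: "cdf (distr M borel Y) = F"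
    and offer_pos_integrable: "integrable M (\<lambda>\<omega>. max (Y \<omega>) 0)"
begin

abbreviation excess :: "real \<Rightarrow> 'a \<Rightarrow> real" where "excess x \<omega> \<equiv> max (Y \<omega> - x) 0"

lemma excess_integrable: "integrable M (excess x)"
proof (rule Bochner_Integration.integrable_bound)
  show "integrable M (\<lambda>\<omega>. max (Y \<omega>) 0 + \<bar>x\<bar>)" using offer_pos_integrable by simp
qed auto

lemma tail_prob: "1 - F u = prob {\<omega> \<in> space M. u < Y \<omega>}"
proof -
  have "F u = prob {\<omega> \<in> space M. Y \<omega> \<le> u}"
    unfolding offer_cdf[symmetric] cdf_def by (subst measure_distr) (auto intro!: arg_cong[where f=prob])
  moreover have "prob {\<omega> \<in> space M. \<not> Y \<omega> \<le> u} = 1 - prob {\<omega> \<in> space M. Y \<omega> \<le> u}"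
    by (rule prob_neg) measurable
  ultimately show ?thesis by (simp add: not_le)
qed

lemma tail_prob_integral: "1 - F x = expectation (\<lambda>\<omega>. indicator {..<Y \<omega>} x)"
proof -
  have "expectation (\<lambda>\<omega>. indicator {..<Y \<omega>} x) = expectation (indicator {\<omega> \<in> space M. x < Y \<omega>})"
    by (intro Bochner_Integration.integral_cong) (auto simp: indicator_def)
  also have "\<dots> = prob {\<omega> \<in> space M. x < Y \<omega>}" by simp
  finally show ?thesis by (simp add: tail_prob)
qed

text \<open>
  Integrating a tail moment over its truncation point raises the order by one, by Tonelli's theorem.
  The case \<open>n = 0\<close> is the layer cake formula for \<open>\<phi>\<close>, and \<open>n = 1\<close> does the same for the integral of \<open>\<phi>\<close>.
  The indicator keeps the case \<open>n = 0\<close> correct, where the power alone would not vanish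
  beyond \<open>Y\<close>.
\<close>

lemma tail_moment:
  assumes int: "integrable M (\<lambda>\<omega>. excess w \<omega> ^ Suc n)"
  shows "has_bochner_integral lborel
    (\<lambda>x. indicator {w<..} x * expectation (\<lambda>\<omega>. (Y \<omega> - x) ^ n * indicator {..<Y \<omega>} x))
    (expectation (\<lambda>\<omega>. excess w \<omega> ^ Suc n) / Suc n)"
proof (rule has_bochner_integral_nn_integral)
  interpret P: pair_sigma_finite M lborel by unfold_locales
  let ?k = "\<lambda>x \<omega>. (Y \<omega> - x) ^ n * indicator {..<Y \<omega>} x"
  have k_meas [measurable]: "(\<lambda>(\<omega>, x). ?k x \<omega>) \<in> borel_measurable (M \<Otimes>\<^sub>M lborel)"
    unfolding indicator_def lessThan_iff by measurable
  have k_nonneg: "0 \<le> ?k x \<omega>" for x \<omega> by (auto simp: indicator_def)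
  have k_int: "integrable M (?k x)" if "w < x" for x
  proof (rule Bochner_Integration.integrable_bound)
    show "integrable M (\<lambda>\<omega>. 1 + excess w \<omega> ^ Suc n)" using int by simp
    \<comment> \<open>\<open>z ^ n \<le> 1 + z ^ (n + 1)\<close> for \<open>z \<ge> 0\<close>, so the lower moment is finite as well.\<close>
    have "\<bar>?k x \<omega>\<bar> \<le> 1 + excess w \<omega> ^ Suc n" for \<omega>
    proof (cases "x < Y \<omega>")
      case True
      then have "(Y \<omega> - x) ^ n \<le> excess w \<omega> ^ n" using that by (intro power_mono) auto
      also have "\<dots> \<le> 1 + excess w \<omega> ^ Suc n"
      proof (cases "excess w \<omega> \<le> 1")
        case True
        then have "excess w \<omega> ^ n \<le> 1" by (intro power_le_one) auto
        moreover have "0 \<le> excess w \<omega> ^ Suc n" by (intro zero_le_power) auto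
        ultimately show ?thesis by linarith
      next
        case False
        then have "excess w \<omega> ^ n \<le> excess w \<omega> ^ Suc n" by (intro power_increasing) auto
        then show ?thesis by linarith
      qed
      finally show ?thesis using True by simp
    next
      case False
      have "0 \<le> excess w \<omega> ^ Suc n" by (intro zero_le_power) auto
      with False show ?thesis by simp
    qed
    then show "AE \<omega> in M. norm (?k x \<omega>) \<le> norm (1 + excess w \<omega> ^ Suc n)"
      unfolding real_norm_def by (intro AE_I2 order_trans[OF _ abs_ge_self])
    show "?k x \<in> borel_measurable M" unfolding indicator_def lessThan_iff by measurable
  qed
  show "(\<lambda>x. indicator {w<..} x * expectation (?k x)) \<in> borel_measurable lborel"
    by measurable
  show "AE x in lborel. 0 \<le> indicator {w<..} x * expectation (?k x)"
    by (intro AE_I2 mult_nonneg_nonneg Bochner_Integration.integral_nonneg k_nonneg) auto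
  show "0 \<le> expectation (\<lambda>\<omega>. excess w \<omega> ^ Suc n) / Suc n"
    by (intro divide_nonneg_nonneg Bochner_Integration.integral_nonneg zero_le_power) auto
  have "(\<integral>\<^sup>+ x. ennreal (indicator {w<..} x * expectation (?k x)) \<partial>lborel)
      = (\<integral>\<^sup>+ x. (\<integral>\<^sup>+ \<omega>. ennreal (indicator {w<..} x * ?k x \<omega>) \<partial>M) \<partial>lborel)"
  proof (intro nn_integral_cong)
    fix x
    show "ennreal (indicator {w<..} x * expectation (?k x)) = (\<integral>\<^sup>+ \<omega>. ennreal (indicator {w<..} x * ?k x \<omega>) \<partial>M)"
    proof (cases "w < x")
      case True
      then show ?thesis using nn_integral_eq_integral[OF k_int[OF True]] k_nonneg by simp
    qed simp
  qed
  also have "\<dots> = (\<integral>\<^sup>+ \<omega>. (\<integral>\<^sup>+ x. ennreal (indicator {w<..} x * ?k x \<omega>) \<partial>lborel) \<partial>M)"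
    by (rule P.Fubini') measurable
  also have "\<dots> = (\<integral>\<^sup>+ \<omega>. ennreal (excess w \<omega> ^ Suc n / Suc n) \<partial>M)"
    unfolding nn_integral_truncated_power ..
  also have "\<dots> = ennreal (expectation (\<lambda>\<omega>. excess w \<omega> ^ Suc n / Suc n))"
    by (rule nn_integral_eq_integral) (use int in \<open>auto intro!: AE_I2 divide_nonneg_nonneg zero_le_power mult_nonneg_nonneg\<close>)
  also have "expectation (\<lambda>\<omega>. excess w \<omega> ^ Suc n / Suc n) = expectation (\<lambda>\<omega>. excess w \<omega> ^ Suc n) / Suc n"
    by simp
  finally show "(\<integral>\<^sup>+ x. ennreal (indicator {w<..} x * expectation (?k x)) \<partial>lborel)
      = ennreal (expectation (\<lambda>\<omega>. excess w \<omega> ^ Suc n) / Suc n)" .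
qed

abbreviation phi :: "real \<Rightarrow> real" where "phi \<equiv> tail_integral F"

lemma phi_eq: "phi x = expectation (excess x)"
  using tail_moment[of x 0] excess_integrable
  by (simp add: tail_integral_def interval_integral_to_infinity_eq set_lebesgue_integral_def
      tail_prob_integral[symmetric] has_bochner_integral_iff)

text \<open>
  Monotonicity and the Lipschitz bound hold at every point, whereas \<open>\<phi>\<close> is not differentiable at the
  atoms of \<open>F\<close>.
\<close>

lemma phi_diff:
  assumes "x \<le> y"
  shows "phi y \<le> phi x" "phi x - phi y \<le> y - x"
proof -
  show "phi y \<le> phi x"
    unfolding phi_eq using assms excess_integrable by (intro integral_mono) auto
  have "phi x \<le> expectation (\<lambda>\<omega>. excess y \<omega> + (y - x))"
    unfolding phi_eq using assms excess_integrable by (intro integral_mono) auto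
  also have "\<dots> = phi y + (y - x)"
    unfolding phi_eq using excess_integrable by (simp add: prob_space)
  finally show "phi x - phi y \<le> y - x" by simp
qed

lemma phi_continuous: "continuous_on A phi"
proof (rule continuous_on_subset)
  have "\<bar>phi x - phi y\<bar> \<le> 1 * \<bar>x - y\<bar>" for x y
    using phi_diff[of x y] phi_diff[of y x] by (cases "x \<le> y") auto
  then have "1-lipschitz_on UNIV phi"
    by (intro lipschitz_onI) (auto simp: dist_real_def)
  then show "continuous_on UNIV phi" by (rule lipschitz_on_continuous_on)
qed simp

lemma phi_pos:
  assumes "ereal x < upper_endpoint F"
  shows "0 < phi x"
proof -
  obtain y where y: "F y < 1" "x < y"
    using assms by (auto simp: upper_endpoint_def less_Sup_iff)
  have "(y - x) * (1 - F y) = expectation (\<lambda>\<omega>. (y - x) * indicator {\<omega> \<in> space M. y < Y \<omega>} \<omega>)"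
    by (simp add: tail_prob)
  also have "\<dots> \<le> phi x"
    unfolding phi_eq
  proof (intro integral_mono excess_integrable)
    show "integrable M (\<lambda>\<omega>. (y - x) * indicator {\<omega> \<in> space M. y < Y \<omega>} \<omega>)"
      by (intro integrable_mult_right integrable_real_indicator) (auto simp: less_top[symmetric])
  qed (use y in \<open>auto simp: indicator_def\<close>)
  finally show ?thesis using y by (smt (verit) mult_pos_pos)
qed

text \<open>
  Since \<open>\<phi>\<close> vanishes at a finite upper endpoint and is 1-Lipschitz, it decays at least linearly there.
  This is what makes \<open>Psi\<close> diverge.
\<close>

lemma phi_le_distance_to_endpoint:
  assumes "upper_endpoint F = ereal b" "x \<le> b"
  shows "phi x \<le> b - x"
proof -
  have "1 - F u = 0" if "b < u" for u
  proof -
    have "\<not> F u < 1"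
    proof
      assume "F u < 1"
      then have "ereal u \<le> upper_endpoint F" unfolding upper_endpoint_def by (intro Sup_upper) auto
      with assms that show False by simp
    qed
    moreover have "0 \<le> 1 - F u" unfolding tail_prob by simp
    ultimately show ?thesis by simp
  qed
  then have "(\<lambda>u. indicator {b<..} u *\<^sub>R (1 - F u)) = (\<lambda>_. 0)" by (auto simp: indicator_def fun_eq_iff)
  then have "phi b = 0"
    unfolding tail_integral_def interval_integral_to_infinity_eq set_lebesgue_integral_def by simp
  with phi_diff(2)[OF assms(2)] show ?thesis by simp
qed

text \<open>
  The interval of continuity is taken to extend beyond both \<open>m\<close> and \<open>x\<close>; in particular the derivative at
  the start \<open>m\<close> is two-sided.
\<close>

lemma antiderivative:
  assumes cont: "\<And>a b. ereal b < upper_endpoint F \<Longrightarrow> continuous_on {a..b} h"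
    and m: "ereal m < upper_endpoint F" and x: "ereal x < upper_endpoint F"
  shows "((\<lambda>x. LBINT u=ereal m..ereal x. h u) has_real_derivative h x) (at x)"
proof -
  have "ereal (max m x) < upper_endpoint F" using m x by (auto simp: max_def)
  then obtain y where y: "F y < 1" "max m x < y"
    by (auto simp: upper_endpoint_def less_Sup_iff)
  define b where "b = (max m x + y) / 2"
  have b: "max m x < b" "b < y" using y by (auto simp: b_def)
  have "ereal y \<le> upper_endpoint F" unfolding upper_endpoint_def using y by (intro Sup_upper) auto
  moreover have "ereal b < ereal y" using b by simp
  ultimately have "ereal b < upper_endpoint F" by (rule less_le_trans[rotated])
  then have "continuous_on {min m x - 1..b} h" by (rule cont)
  then show ?thesis
    using b by (intro interval_integral_has_real_derivative[of "min m x - 1" _ b]) auto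
qed

lemma endpoint_mono: "ereal y < upper_endpoint F \<Longrightarrow> x \<le> y \<Longrightarrow> ereal x < upper_endpoint F"
  using le_less_trans[of "ereal x" "ereal y"] by simp

lemma continuous_inverse_phi:
  assumes "ereal b < upper_endpoint F"
  shows "continuous_on {a..b} (\<lambda>u. 1 / phi u)"
proof (intro continuous_intros phi_continuous ballI)
  fix u assume "u \<in> {a..b}"
  then show "phi u \<noteq> 0" using phi_pos[OF endpoint_mono[OF assms, of u]] by simp
qed

context
  fixes m :: real
  assumes m_less: "ereal m < upper_endpoint F"
begin

lemma Psi_derivative:
  "ereal x < upper_endpoint F \<Longrightarrow> (Psi F m has_real_derivative 1 / phi x) (at x)"
  unfolding Psi_def[abs_def] by (intro antiderivative continuous_inverse_phi m_less)

lemma Psi_start [simp]: "Psi F m m = 0"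
  by (simp add: Psi_def)

lemma Psi_growth:
  assumes "m \<le> x" "x \<le> y" "ereal y < upper_endpoint F"
  shows "(y - x) / phi m \<le> Psi F m y - Psi F m x"
proof -
  have "Psi F m x - x / phi m \<le> Psi F m y - y / phi m"
  proof (rule DERIV_nonneg_imp_nondecreasing[OF \<open>x \<le> y\<close>])
    fix z assume z: "x \<le> z" "z \<le> y"
    then have zl: "ereal z < upper_endpoint F" using endpoint_mono assms by blast
    have "1 / phi m \<le> 1 / phi z"
      using phi_diff(1)[of m z] phi_pos[OF zl] assms z by (intro divide_left_mono) auto
    moreover have "((\<lambda>z. Psi F m z - z / phi m) has_real_derivative 1 / phi z - 1 / phi m) (at z)"
      by (intro DERIV_diff Psi_derivative zl DERIV_cdivide DERIV_ident)
    ultimately show "\<exists>d. ((\<lambda>z. Psi F m z - z / phi m) has_real_derivative d) (at z) \<and> 0 \<le> d"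
      by (intro exI conjI) auto
  qed
  then show ?thesis by (simp add: diff_divide_distrib)
qed

lemma Psi_strict_mono:
  assumes "m \<le> x" "x < y" "ereal y < upper_endpoint F"
  shows "Psi F m x < Psi F m y"
proof -
  have "0 < (y - x) / phi m" using assms phi_pos[OF m_less] by simp
  with Psi_growth[of x y] assms show ?thesis by linarith
qed

text \<open>
  If the upper endpoint \<open>b\<close> is finite, \<open>1 / \<phi> u \<ge> 1 / (b - u)\<close> and \<open>Psi\<close> grows at least like a logarithm;
  if it is infinite, \<open>1 / \<phi>\<close> is bounded below by \<open>1 / \<phi> m\<close> and \<open>Psi\<close> grows linearly.
\<close>

lemma Psi_unbounded:
  assumes "0 \<le> T"
  obtains x where "m \<le> x" "ereal x < upper_endpoint F" "T \<le> Psi F m x"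
proof (cases "upper_endpoint F")
  case (real b)
  have mb: "m < b" using m_less real by simp
  \<comment> \<open>The point at which \<open>ln ((b - m) / (b - x))\<close> equals \<open>T\<close>.\<close>
  define x where "x = b - (b - m) * exp (- T)"
  have x: "m \<le> x" "x < b"
  proof -
    have "(b - m) * exp (- T) \<le> (b - m) * 1" using assms mb by (intro mult_left_mono) auto
    then show "m \<le> x" by (simp add: x_def)
    show "x < b" using mb by (simp add: x_def)
  qed
  have "Psi F m m + ln (b - m) \<le> Psi F m x + ln (b - x)"
  proof (rule DERIV_nonneg_imp_nondecreasing[OF \<open>m \<le> x\<close>])
    fix z assume z: "m \<le> z" "z \<le> x"
    then have zl: "ereal z < upper_endpoint F" using real x by simp
    have "1 / (b - z) \<le> 1 / phi z"
      using phi_le_distance_to_endpoint[OF real, of z] phi_pos[OF zl] z x by (intro divide_left_mono) auto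
    moreover have "((\<lambda>z. Psi F m z + ln (b - z)) has_real_derivative 1 / phi z - 1 / (b - z)) (at z)"
      by (auto intro!: derivative_eq_intros Psi_derivative zl) (use z x in auto)
    ultimately show "\<exists>d. ((\<lambda>z. Psi F m z + ln (b - z)) has_real_derivative d) (at z) \<and> 0 \<le> d"
      by (intro exI conjI) auto
  qed
  moreover have "ln (b - x) = ln (b - m) - T"
    using mb by (simp add: x_def ln_mult)
  ultimately have "T \<le> Psi F m x" by simp
  with x real show ?thesis by (intro that[of x]) auto
next
  case PInf
  have "T \<le> Psi F m (m + T * phi m)"
    using Psi_growth[of m "m + T * phi m"] assms phi_pos[OF m_less] PInf by simp
  then show ?thesis using PInf assms phi_pos[OF m_less] by (intro that[of "m + T * phi m"]) auto
next
  case MInf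
  with m_less show ?thesis by simp
qed

lemma Psi_onto:
  assumes "0 \<le> T"
  shows "T \<in> Psi F m ` {x. m \<le> x \<and> ereal x < upper_endpoint F}"
proof -
  obtain x where x: "m \<le> x" "ereal x < upper_endpoint F" "T \<le> Psi F m x"
    using Psi_unbounded[OF assms] .
  have "continuous_on {m..x} (Psi F m)"
    by (rule DERIV_continuous_on, rule has_field_derivative_at_within, rule Psi_derivative)
      (use endpoint_mono[OF x(2)] in auto)
  then obtain z where "m \<le> z" "z \<le> x" "Psi F m z = T"
    using IVT'[of "Psi F m" m T x] x assms by auto
  with endpoint_mono[OF x(2)] show ?thesis by auto
qed

context
  fixes lam :: real
  assumes lam_pos: "0 < lam"
begin

abbreviation policy :: "real \<Rightarrow> real" where "policy \<equiv> optimal_policy lam F m"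

text \<open>
  By strict monotonicity and \<open>Psi_onto\<close>, the function \<open>Psi\<close> is a bijection onto \<open>[0, \<infinity>)\<close>, so the
  inverse in the definition of the policy is a genuine one.
\<close>

lemma policy_props:
  assumes "0 \<le> r"
  shows "m \<le> policy r" "ereal (policy r) < upper_endpoint F" "Psi F m (policy r) = lam * r"
proof -
  let ?A = "{x. m \<le> x \<and> ereal x < upper_endpoint F}"
  have inj: "inj_on (Psi F m) ?A"
  proof (rule linorder_inj_onI)
    fix x y assume "x < y" "x \<in> ?A" "y \<in> ?A"
    then show "Psi F m x \<noteq> Psi F m y" using Psi_strict_mono[of x y] by simp
  qed auto
  have T: "lam * r \<in> Psi F m ` ?A" using assms lam_pos by (intro Psi_onto) simp
  show "Psi F m (policy r) = lam * r"
    unfolding optimal_policy_def by (rule f_the_inv_into_f[OF inj T])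
  have "policy r \<in> ?A"
    unfolding optimal_policy_def by (rule the_inv_into_into[OF inj T order_refl])
  then show "m \<le> policy r" "ereal (policy r) < upper_endpoint F" by auto
qed

lemma policy_start: "policy 0 = m"
proof (rule ccontr)
  assume "policy 0 \<noteq> m"
  then have "Psi F m m < Psi F m (policy 0)" using policy_props[of 0] by (intro Psi_strict_mono) auto
  then show False using policy_props(3)[of 0] by simp
qed

lemma policy_strict_mono:
  assumes "0 \<le> r" "r < s"
  shows "policy r < policy s"
proof (rule ccontr)
  assume "\<not> policy r < policy s"
  then have "Psi F m (policy s) \<le> Psi F m (policy r)"
    using policy_props[of r] policy_props[of s] assms Psi_strict_mono[of "policy s" "policy r"]
    by (cases "policy s = policy r") auto
  then show False using policy_props(3)[of r] policy_props(3)[of s] assms lam_pos by simp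
qed

text \<open>
  The derivative of \<open>Psi\<close> is at least \<open>1 / \<phi> m\<close> on the range of the policy, which bounds the slope
  of the inverse.
\<close>

lemma policy_lipschitz:
  assumes "0 \<le> r" "r \<le> s"
  shows "policy s - policy r \<le> lam * phi m * (s - r)"
proof (cases "r = s")
  case False
  then have "policy r < policy s" using policy_strict_mono assms by simp
  then have "(policy s - policy r) / phi m \<le> lam * (s - r)"
    using Psi_growth[of "policy r" "policy s"] policy_props[of r] policy_props[of s] assms
    by (simp add: right_diff_distrib)
  then show ?thesis using phi_pos[OF m_less] by (simp add: pos_divide_le_eq mult_ac)
qed simp

lemma policy_continuous: "continuous_on {0..} policy"
proof -
  have *: "\<bar>policy s - policy r\<bar> \<le> lam * phi m * \<bar>s - r\<bar>" if "0 \<le> r" "r \<le> s" for r s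
    using policy_lipschitz[OF that] policy_strict_mono[of r s] that by (cases "r = s") auto
  have "\<bar>policy r - policy s\<bar> \<le> lam * phi m * \<bar>r - s\<bar>" if "0 \<le> r" "0 \<le> s" for r s
    using *[of r s] *[of s r] that by (cases "r \<le> s") (auto simp: abs_minus_commute)
  then have "(lam * phi m)-lipschitz_on {0..} policy"
    using lam_pos phi_pos[OF m_less] by (intro lipschitz_onI) (auto simp: dist_real_def)
  then show ?thesis by (rule lipschitz_on_continuous_on)
qed

text \<open>
  The differential equation of the policy, from the derivative of an inverse function.
\<close>

lemma policy_derivative:
  assumes "0 < r"
  shows "(policy has_real_derivative lam * phi (policy r)) (at r)"
proof -
  have pr: "ereal (policy r) < upper_endpoint F" using policy_props assms by simp
  have "(policy has_real_derivative inverse (1 / phi (policy r) / lam)) (at r)"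
  proof (rule DERIV_inverse_function[of "\<lambda>x. Psi F m x / lam" _ _ _ 0 "r + 1"])
    show "((\<lambda>x. Psi F m x / lam) has_real_derivative 1 / phi (policy r) / lam) (at (policy r))"
      by (intro DERIV_cdivide Psi_derivative pr)
    show "1 / phi (policy r) / lam \<noteq> 0" using phi_pos[OF pr] lam_pos by simp
    show "Psi F m (policy y) / lam = y" if "0 < y" "y < r + 1" for y
      using policy_props(3)[of y] that lam_pos by simp
    have "continuous_on {0<..} policy" by (rule continuous_on_subset[OF policy_continuous]) auto
    then show "isCont policy r" using assms by (simp add: continuous_on_eq_continuous_at)
  qed (use assms in auto)
  then show ?thesis by (simp add: field_simps)
qed

end

end

end

section \<open>The moments of the price along the optimal policy\<close>

lemma continuous_on_interval_bounded:
  fixes f :: "real \<Rightarrow> real"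
  assumes "continuous_on {a..b} f"
  obtains N where "0 \<le> N" "\<And>r. a \<le> r \<Longrightarrow> r \<le> b \<Longrightarrow> \<bar>f r\<bar> \<le> N"
proof -
  have "bounded (f ` {a..b})"
    by (intro compact_imp_bounded compact_continuous_image assms compact_Icc)
  then obtain N where N: "\<forall>x\<in>f ` {a..b}. norm x \<le> N" by (auto simp: bounded_iff)
  show ?thesis
    by (rule that[of "max N 0"]) (use N in \<open>auto simp: le_max_iff_disj\<close>)
qed

text \<open>
  With a second moment, the iterated tail integral \<open>\<Phi>\<close> is finite as well.
\<close>

locale square_integrable_offers = offer_distribution +
  assumes offer_pos_square_integrable: "integrable M (\<lambda>\<omega>. (max (Y \<omega>) 0)\<^sup>2)"
begin

lemma excess_square_integrable: "integrable M (\<lambda>\<omega>. (excess w \<omega>)\<^sup>2)"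
proof (rule Bochner_Integration.integrable_bound)
  show "integrable M (\<lambda>\<omega>. 2 * (max (Y \<omega>) 0)\<^sup>2 + 2 * w\<^sup>2)"
    using offer_pos_square_integrable by simp
  have "(excess w \<omega>)\<^sup>2 \<le> 2 * (max (Y \<omega>) 0)\<^sup>2 + 2 * w\<^sup>2" for \<omega>
  proof -
    have "(excess w \<omega>)\<^sup>2 \<le> (max (Y \<omega>) 0 + \<bar>w\<bar>)\<^sup>2" by (intro power_mono) auto
    also have "\<dots> \<le> 2 * (max (Y \<omega>) 0)\<^sup>2 + 2 * \<bar>w\<bar>\<^sup>2"
      using zero_le_power2[of "max (Y \<omega>) 0 - \<bar>w\<bar>"] by (simp only: power2_sum power2_diff)
    finally show ?thesis by simp
  qed
  then show "AE \<omega> in M. norm ((excess w \<omega>)\<^sup>2) \<le> norm (2 * (max (Y \<omega>) 0)\<^sup>2 + 2 * w\<^sup>2)"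
    by simp
qed simp

abbreviation Phi :: "real \<Rightarrow> real" where "Phi w \<equiv> (LBINT x=ereal w..\<infinity>. phi x)"

lemma
  shows phi_integrable: "interval_lebesgue_integrable lborel (ereal w) \<infinity> phi"
    and Phi_eq: "Phi w = expectation (\<lambda>\<omega>. (excess w \<omega>)\<^sup>2) / 2"
proof -
  have "expectation (\<lambda>\<omega>. (Y \<omega> - x) ^ 1 * indicator {..<Y \<omega>} x) = phi x" for x
    unfolding phi_eq by (intro Bochner_Integration.integral_cong) (auto simp: indicator_def)
  moreover have "integrable M (\<lambda>\<omega>. excess w \<omega> ^ Suc 1)"
    using excess_square_integrable[of w] by (simp add: numeral_2_eq_2)
  ultimately have "has_bochner_integral lborel (\<lambda>x. indicator {w<..} x * phi x)
      (expectation (\<lambda>\<omega>. (excess w \<omega>)\<^sup>2) / 2)"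
    using tail_moment[of w 1] by (simp add: numeral_2_eq_2)
  then show "interval_lebesgue_integrable lborel (ereal w) \<infinity> phi"
    and "Phi w = expectation (\<lambda>\<omega>. (excess w \<omega>)\<^sup>2) / 2"
    by (auto simp: interval_integrable_to_infinity_eq interval_integral_to_infinity_eq
        set_integrable_def set_lebesgue_integral_def has_bochner_integral_iff)
qed

text \<open>
  From \<open>\<bar>a\<^sup>2 - b\<^sup>2\<bar> \<le> \<bar>a - b\<bar> * (a + b)\<close> for nonnegative \<open>a\<close> and \<open>b\<close>, averaged over the offer.
\<close>

lemma Phi_diff: "\<bar>Phi x - Phi y\<bar> \<le> \<bar>x - y\<bar> * (phi x + phi y) / 2"
proof -
  have pw: "\<bar>(excess x \<omega>)\<^sup>2 - (excess y \<omega>)\<^sup>2\<bar> \<le> \<bar>x - y\<bar> * (excess x \<omega> + excess y \<omega>)" for \<omega>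
  proof -
    have "\<bar>(excess x \<omega>)\<^sup>2 - (excess y \<omega>)\<^sup>2\<bar> = \<bar>excess x \<omega> - excess y \<omega>\<bar> * (excess x \<omega> + excess y \<omega>)"
      by (simp add: power2_eq_square square_diff_square_factored abs_mult mult.commute)
    also have "\<dots> \<le> \<bar>x - y\<bar> * (excess x \<omega> + excess y \<omega>)"
      by (intro mult_right_mono) auto
    finally show ?thesis .
  qed
  have "\<bar>Phi x - Phi y\<bar> = \<bar>expectation (\<lambda>\<omega>. (excess x \<omega>)\<^sup>2 - (excess y \<omega>)\<^sup>2)\<bar> / 2"
    by (simp add: Phi_eq excess_square_integrable diff_divide_distrib[symmetric])
  also have "\<dots> \<le> expectation (\<lambda>\<omega>. \<bar>(excess x \<omega>)\<^sup>2 - (excess y \<omega>)\<^sup>2\<bar>) / 2"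
    by (intro divide_right_mono integral_abs_bound) simp
  also have "\<dots> \<le> expectation (\<lambda>\<omega>. \<bar>x - y\<bar> * (excess x \<omega> + excess y \<omega>)) / 2"
    by (intro divide_right_mono integral_mono pw)
       (auto intro!: excess_integrable excess_square_integrable)
  also have "\<dots> = \<bar>x - y\<bar> * (phi x + phi y) / 2"
    by (simp add: phi_eq excess_integrable)
  finally show ?thesis .
qed

lemma Phi_continuous: "continuous_on A Phi"
proof -
  have "isCont Phi y" for y
  proof -
    have phi: "isCont phi x" for x
      using phi_continuous[of UNIV] by (simp add: continuous_on_eq_continuous_at)
    have "((\<lambda>x. \<bar>x - y\<bar> * (phi x + phi y) / 2) \<longlongrightarrow> \<bar>y - y\<bar> * (phi y + phi y) / 2) (at y)"
      using phi[of y] by (intro tendsto_intros) (auto simp: isCont_def)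
    then have "((\<lambda>x. \<bar>x - y\<bar> * (phi x + phi y) / 2) \<longlongrightarrow> 0) (at y)" by simp
    then have "((\<lambda>x. Phi x - Phi y) \<longlongrightarrow> 0) (at y)"
      by (rule Lim_null_comparison[rotated])
         (unfold real_norm_def, intro always_eventually allI Phi_diff)
    then show ?thesis unfolding isCont_def by (rule LIM_zero_cancel)
  qed
  then show ?thesis by (intro continuous_at_imp_continuous_on) auto
qed

lemma variance_excess: "variance (excess w) = 2 * Phi w - (phi w)\<^sup>2"
proof -
  have "variance (excess w) = expectation (\<lambda>\<omega>. (excess w \<omega>)\<^sup>2) - (phi w)\<^sup>2"
    using variance_eq[OF excess_integrable excess_square_integrable, of w] by (simp only: phi_eq)
  then show ?thesis using Phi_eq[of w] by simp
qed

lemma continuous_rate: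
  assumes "ereal b < upper_endpoint F"
  shows "continuous_on {a..b} (\<lambda>u. 1 / (phi u)\<^sup>2 * Phi u)"
proof (intro continuous_intros phi_continuous Phi_continuous ballI)
  fix u assume "u \<in> {a..b}"
  then show "(phi u)\<^sup>2 \<noteq> 0" using phi_pos[OF endpoint_mono[OF assms, of u]] by simp
qed

end

text \<open>
  The policy started at \<open>m\<close>.  The constant \<open>c\<close> is the initial value of \<open>U\<close>; for the bidding process it
  will be \<open>Var [X 0] / \<phi> m\<close>.
\<close>

locale optimal_selling = square_integrable_offers +
  fixes m lam c :: real
  assumes start_below_endpoint: "ereal m < upper_endpoint F"
    and rate_positive: "0 < lam"
begin

lemmas policy_facts = policy_props[OF start_below_endpoint rate_positive]

text \<open>
  The policy, frozen at its initial value for negative times: this is continuous on the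
  whole line, hence Borel, and the bidding process sees positive times only.
\<close>

definition p :: "real \<Rightarrow> real" where "p r = optimal_policy lam F m (max r 0)"
definition J :: "real \<Rightarrow> real" where "J x = (LBINT u=ereal m..ereal x. 1 / (phi u)\<^sup>2 * Phi u)"
text \<open>
  The variance of the sale price divided by \<open>\<phi>\<close> at the current threshold, obtained by variation of constants.
\<close>

definition U :: "real \<Rightarrow> real" where "U r = c + 2 * J (p r)"

lemma p_ge: "m \<le> p r" and p_less: "ereal (p r) < upper_endpoint F"
  using policy_facts[of "max r 0"] by (auto simp: p_def)

lemma phi_p_pos: "0 < phi (p r)"
  by (rule phi_pos[OF p_less])

lemma p_start: "p 0 = m"
  by (simp add: p_def policy_start[OF start_below_endpoint rate_positive])

lemma U_start: "U 0 = c"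
  by (simp add: U_def p_start J_def)

lemma p_continuous: "continuous_on A p"
proof (rule continuous_on_subset)
  show "continuous_on UNIV p"
    unfolding p_def[abs_def]
    by (rule continuous_on_compose2[OF policy_continuous[OF start_below_endpoint rate_positive]])
       (auto intro!: continuous_intros)
qed simp

lemma p_strict_mono: "0 \<le> r \<Longrightarrow> r < s \<Longrightarrow> p r < p s"
  using policy_strict_mono[OF start_below_endpoint rate_positive, of r s] by (simp add: p_def)

lemma p_derivative:
  assumes "0 < r"
  shows "(p has_real_derivative lam * phi (p r)) (at r)"
proof (rule has_field_derivative_transform_within_open)
  show "(optimal_policy lam F m has_real_derivative lam * phi (p r)) (at r)"
    using policy_derivative[OF start_below_endpoint rate_positive assms] assms by (simp add: p_def)
  show "open {0::real<..}" by simp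
qed (use assms in \<open>auto simp: p_def\<close>)

lemma J_derivative:
  "ereal x < upper_endpoint F \<Longrightarrow> (J has_real_derivative 1 / (phi x)\<^sup>2 * Phi x) (at x)"
  unfolding J_def[abs_def] by (rule antiderivative[OF continuous_rate start_below_endpoint])

lemma U_continuous: "continuous_on A U"
proof -
  have "isCont J x" if "ereal x < upper_endpoint F" for x
    using J_derivative[OF that] by (rule DERIV_isCont)
  then have "continuous_on (range p) J"
    by (intro continuous_at_imp_continuous_on) (auto intro: p_less)
  then have "continuous_on A (\<lambda>r. J (p r))"
    by (rule continuous_on_compose2[OF _ p_continuous]) auto
  then show ?thesis unfolding U_def[abs_def] by (intro continuous_intros)
qed

lemma U_derivative:
  assumes "0 < r"
  shows "(U has_real_derivative 2 * lam * Phi (p r) / phi (p r)) (at r)"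
proof -
  have "(U has_real_derivative 0 + 2 * (1 / (phi (p r))\<^sup>2 * Phi (p r) * (lam * phi (p r)))) (at r)"
    unfolding U_def[abs_def]
    by (intro DERIV_add DERIV_const DERIV_cmult DERIV_chain2[OF J_derivative] p_less p_derivative assms)
  moreover have "0 + 2 * (1 / (phi (p r))\<^sup>2 * Phi (p r) * (lam * phi (p r))) = 2 * lam * Phi (p r) / phi (p r)"
    using phi_p_pos[of r] by (simp add: field_simps power2_eq_square)
  ultimately show ?thesis by simp
qed

lemma phi_p_continuous: "continuous_on A (\<lambda>r. phi (p r))"
  by (rule continuous_on_compose2[OF phi_continuous p_continuous subset_UNIV])

lemma Phi_p_continuous: "continuous_on A (\<lambda>r. Phi (p r))"
  by (rule continuous_on_compose2[OF Phi_continuous p_continuous subset_UNIV])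

lemma measurable_along_policy [measurable]:
  "p \<in> borel_measurable borel" "U \<in> borel_measurable borel"
  "(\<lambda>r. phi (p r)) \<in> borel_measurable borel" "(\<lambda>r. Phi (p r)) \<in> borel_measurable borel"
  by (intro borel_measurable_continuous_onI p_continuous U_continuous phi_p_continuous Phi_p_continuous)+

text \<open>
  The expected value of the better of the offer and the threshold is \<open>p r + \<phi> (p r)\<close>, so the equation is
  the policy's own differential equation \<open>p' = lam * \<phi> p\<close> with integrating factor
  \<open>exp (lam * r)\<close>.
\<close>

lemma mean_equation:
  assumes "0 \<le> s"
  shows "((\<lambda>r. lam * exp (lam * r) * expectation (\<lambda>\<omega>. if p r \<le> Y \<omega> then Y \<omega> else p r))
    has_integral (exp (lam * s) * p s - p 0)) {0..s}"
proof -
  have E: "expectation (\<lambda>\<omega>. if p r \<le> Y \<omega> then Y \<omega> else p r) = p r + phi (p r)" for r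
  proof -
    have "expectation (\<lambda>\<omega>. if p r \<le> Y \<omega> then Y \<omega> else p r) = expectation (\<lambda>\<omega>. p r + excess (p r) \<omega>)"
      by (intro Bochner_Integration.integral_cong) auto
    then show ?thesis by (simp add: phi_eq excess_integrable prob_space)
  qed
  have "((\<lambda>r. lam * exp (lam * r) * (p r + phi (p r))) has_integral
      (exp (lam * s) * p s - exp (lam * 0) * p 0)) {0..s}"
  proof (rule fundamental_theorem_of_calculus_interior[OF assms])
    show "continuous_on {0..s} (\<lambda>r. exp (lam * r) * p r)"
      by (intro continuous_intros p_continuous)
    fix r assume "r \<in> {0<..<s}"
    then have "((\<lambda>r. exp (lam * r) * p r) has_real_derivative lam * exp (lam * r) * (p r + phi (p r))) (at r)"
      by (auto intro!: derivative_eq_intros p_derivative simp: algebra_simps)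
    then show "((\<lambda>r. exp (lam * r) * p r) has_vector_derivative lam * exp (lam * r) * (p r + phi (p r))) (at r)"
      by (simp add: has_real_derivative_iff_has_vector_derivative)
  qed
  then show ?thesis by (simp add: E)
qed

text \<open>
  The derivative of \<open>exp (lam * r) * ((p r)\<^sup>2 + (y - p r)\<^sub>+ * U r)\<close> divided by \<open>lam * exp (lam * r)\<close>.
  Averaging \<open>(y - p r)\<^sub>+ * U r\<close> over the offer \<open>y\<close> gives \<open>\<phi> (p r) * U r\<close>, the candidate for the variance.
  At the kink \<open>p r = y\<close> this is the derivative of the branch on which the offer is accepted, in
  accordance with the rule \<open>p r \<le> y\<close>; hence \<open>expectation_k\<close> holds for every \<open>r\<close>, even if \<open>F\<close> has an
  atom at \<open>p r\<close>.
\<close>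

definition k :: "real \<Rightarrow> real \<Rightarrow> real" where
  "k r y = (p r)\<^sup>2 + max (y - p r) 0 * U r + 2 * p r * phi (p r)
     - (if p r \<le> y then phi (p r) * U r else 0) + max (y - p r) 0 * (2 * Phi (p r) / phi (p r))"

lemma excess_along_policy_derivative:
  assumes "0 < r" "p r \<noteq> y"
  shows "((\<lambda>r. max (y - p r) 0) has_real_derivative (if p r \<le> y then - (lam * phi (p r)) else 0)) (at r)"
proof (cases "p r < y")
  case True
  have "((\<lambda>r. y - p r) has_real_derivative 0 - lam * phi (p r)) (at r)"
    by (intro DERIV_diff DERIV_const p_derivative assms)
  then have "((\<lambda>r. max (y - p r) 0) has_real_derivative 0 - lam * phi (p r)) (at r)"
  proof (rule has_field_derivative_transform_within_open)
    show "open {r. p r < y}"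
      by (intro open_Collect_less p_continuous continuous_intros)
  qed (use True in auto)
  with True show ?thesis by simp
next
  case False
  have "((\<lambda>r. max (y - p r) 0) has_real_derivative 0) (at r)"
  proof (rule has_field_derivative_transform_within_open[OF DERIV_const])
    show "open {r. y < p r}"
      by (intro open_Collect_less p_continuous continuous_intros)
  qed (use False assms in auto)
  with False assms show ?thesis by simp
qed

text \<open>
  The policy is strictly increasing and meets the level \<open>y\<close> at most once, so the
  fundamental theorem of calculus applies with a single exceptional point.
\<close>

lemma second_moment_kernel:
  assumes "0 \<le> s"
  shows "((\<lambda>r. lam * exp (lam * r) * k r y) has_integral
     (exp (lam * s) * ((p s)\<^sup>2 + max (y - p s) 0 * U s) - ((p 0)\<^sup>2 + max (y - p 0) 0 * U 0))) {0..s}"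
proof -
  let ?G = "\<lambda>r. exp (lam * r) * ((p r)\<^sup>2 + max (y - p r) 0 * U r)"
  let ?C = "{r. 0 < r \<and> p r = y}"
  have "((\<lambda>r. lam * exp (lam * r) * k r y) has_integral (?G s - ?G 0)) {0..s}"
  proof (rule fundamental_theorem_of_calculus_interior_strong[OF _ assms])
    have "inj_on p ?C"
    proof (rule linorder_inj_onI)
      fix r r' assume "r < r'" "r \<in> ?C" "r' \<in> ?C"
      then show "p r \<noteq> p r'" using p_strict_mono[of r r'] by simp
    qed auto
    moreover have "finite (p ` ?C)"
      by (rule finite_subset[of _ "{y}"]) auto
    ultimately show "finite ?C" by (rule finite_imageD[rotated])
    show "continuous_on {0..s} ?G"
      by (intro continuous_intros p_continuous U_continuous)
    fix r assume r: "r \<in> {0<..<s} - ?C"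
    then have r0: "0 < r" and ne: "p r \<noteq> y" by auto
    have "(?G has_real_derivative
        exp (lam * r) * ((2 * p r * (lam * phi (p r))) + ((if p r \<le> y then - (lam * phi (p r)) else 0) * U r
          + max (y - p r) 0 * (2 * lam * Phi (p r) / phi (p r))))
        + lam * exp (lam * r) * ((p r)\<^sup>2 + max (y - p r) 0 * U r)) (at r)"
      by (rule derivative_eq_intros excess_along_policy_derivative[OF r0 ne] U_derivative[OF r0] p_derivative[OF r0] refl)+
         (simp add: algebra_simps)
    also have "exp (lam * r) * ((2 * p r * (lam * phi (p r))) + ((if p r \<le> y then - (lam * phi (p r)) else 0) * U r
          + max (y - p r) 0 * (2 * lam * Phi (p r) / phi (p r))))
        + lam * exp (lam * r) * ((p r)\<^sup>2 + max (y - p r) 0 * U r) = lam * exp (lam * r) * k r y"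
      by (simp add: k_def algebra_simps)
    finally show "(?G has_vector_derivative lam * exp (lam * r) * k r y) (at r)"
      by (simp add: has_real_derivative_iff_has_vector_derivative)
  qed
  then show ?thesis by simp
qed

text \<open>
  The averages agree although the integrands do not: they use \<open>E [(Y - p)\<^sub>+] = \<phi> p\<close> and
  \<open>E [((Y - p)\<^sub>+)\<^sup>2] = 2 * \<Phi> p\<close>, together with the expansion of \<open>Y\<^sup>2\<close> around \<open>p\<close> on \<open>Y \<ge> p\<close>.
\<close>

lemma expectation_k:
  "expectation (\<lambda>\<omega>. k r (Y \<omega>))
    = expectation (\<lambda>\<omega>. if p r \<le> Y \<omega> then (Y \<omega>)\<^sup>2 else (p r)\<^sup>2 + phi (p r) * U r)"
proof -
  let ?I = "\<lambda>\<omega>. if p r \<le> Y \<omega> then phi (p r) * U r else 0"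
  have I: "integrable M ?I"
    by (rule integrable_const_bound[of _ "\<bar>phi (p r) * U r\<bar>"]) auto
  have "expectation (\<lambda>\<omega>. k r (Y \<omega>)) = (p r)\<^sup>2 + phi (p r) * U r + 2 * p r * phi (p r)
     - expectation ?I + phi (p r) * (2 * Phi (p r) / phi (p r))"
    unfolding k_def using I by (simp add: excess_integrable prob_space phi_eq[symmetric])
  also have "\<dots> = 2 * Phi (p r) + 2 * p r * phi (p r) + ((p r)\<^sup>2 + phi (p r) * U r) - expectation ?I"
    using phi_p_pos[of r] by simp
  also have "\<dots> = expectation (\<lambda>\<omega>. (excess (p r) \<omega>)\<^sup>2 + 2 * p r * excess (p r) \<omega> + ((p r)\<^sup>2 + phi (p r) * U r) - ?I \<omega>)"
    using I by (simp add: excess_integrable excess_square_integrable prob_space phi_eq[symmetric] Phi_eq)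
  also have "\<dots> = expectation (\<lambda>\<omega>. if p r \<le> Y \<omega> then (Y \<omega>)\<^sup>2 else (p r)\<^sup>2 + phi (p r) * U r)"
    by (intro Bochner_Integration.integral_cong) (auto simp: power2_eq_square algebra_simps)
  finally show ?thesis .
qed

text \<open>
  The kernel identity averaged over the offer.  Along the compact time interval all coefficients of
  \<open>k\<close> are bounded, and \<open>(Y - p r)\<^sub>+ \<le> (Y - m)\<^sub>+\<close>, which gives the dominating function for
  Fubini's theorem.
\<close>

lemma second_moment_equation:
  assumes s: "0 \<le> s"
  shows "((\<lambda>r. lam * exp (lam * r) * expectation (\<lambda>\<omega>. if p r \<le> Y \<omega> then (Y \<omega>)\<^sup>2 else (p r)\<^sup>2 + phi (p r) * U r))
    has_integral (exp (lam * s) * ((p s)\<^sup>2 + phi (p s) * U s) - ((p 0)\<^sup>2 + phi (p 0) * U 0))) {0..s}"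
proof -
  let ?A = "\<lambda>r. \<bar>(p r)\<^sup>2 + 2 * p r * phi (p r)\<bar> + \<bar>U r\<bar> + \<bar>phi (p r) * U r\<bar> + \<bar>2 * Phi (p r) / phi (p r)\<bar>"
  have "continuous_on {0..s} ?A"
    by (intro continuous_intros p_continuous U_continuous phi_p_continuous Phi_p_continuous ballI)
       (use phi_p_pos in \<open>auto simp: less_imp_neq[symmetric]\<close>)
  then obtain N where N: "0 \<le> N" "\<And>r. 0 \<le> r \<Longrightarrow> r \<le> s \<Longrightarrow> \<bar>?A r\<bar> \<le> N"
    using continuous_on_interval_bounded by blast
  let ?Z = "\<lambda>\<omega>. lam * exp (lam * s) * (2 * N * (1 + excess m \<omega>))"
  let ?H = "\<lambda>\<omega>. exp (lam * s) * ((p s)\<^sup>2 + excess (p s) \<omega> * U s) - ((p 0)\<^sup>2 + excess (p 0) \<omega> * U 0)"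
  have "((\<lambda>r. expectation (\<lambda>\<omega>. lam * exp (lam * r) * k r (Y \<omega>))) has_integral expectation ?H) {0..s}"
  proof (rule expectation_has_integral[where Z = ?Z])
    have "(\<lambda>z. lam * exp (lam * fst z) * k (fst z) (Y (snd z))) \<in> borel_measurable (borel \<Otimes>\<^sub>M M)"
      unfolding k_def by measurable
    then show "(\<lambda>(r, \<omega>). lam * exp (lam * r) * k r (Y \<omega>)) \<in> borel_measurable (lborel \<Otimes>\<^sub>M M)"
      by (simp add: case_prod_beta cong: measurable_cong_sets)
    show "integrable M ?Z" using excess_integrable by simp
    fix r \<omega> assume r: "0 \<le> r" "r \<le> s"
    let ?e = "excess (p r) \<omega>"
    have e: "0 \<le> ?e" "?e \<le> excess m \<omega>" using p_ge[of r] by auto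
    have A: "\<bar>(p r)\<^sup>2 + 2 * p r * phi (p r)\<bar> + \<bar>phi (p r) * U r\<bar> \<le> N"
      and B: "\<bar>U r\<bar> \<le> N" and C: "\<bar>2 * Phi (p r) / phi (p r)\<bar> \<le> N"
      using N(2)[OF r] by linarith+
    have tri: "\<bar>a1 + a2 + a3 - (if b then a4 else 0) + a5\<bar> \<le> \<bar>a1 + a3\<bar> + \<bar>a4\<bar> + \<bar>a2\<bar> + \<bar>a5\<bar>"
      for a1 a2 a3 a4 a5 :: real and b
    proof -
      have "\<bar>a1 + a2 + a3 - x + a5\<bar> \<le> \<bar>a1 + a3\<bar> + \<bar>x\<bar> + \<bar>a2\<bar> + \<bar>a5\<bar>" for x by linarith
      moreover have "\<bar>if b then a4 else 0\<bar> \<le> \<bar>a4\<bar>" by simp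
      ultimately show ?thesis by (meson add_mono order_refl order_trans)
    qed
    have "\<bar>k r (Y \<omega>)\<bar> \<le> \<bar>(p r)\<^sup>2 + 2 * p r * phi (p r)\<bar> + \<bar>phi (p r) * U r\<bar> + \<bar>?e * U r\<bar> + \<bar>?e * (2 * Phi (p r) / phi (p r))\<bar>"
      unfolding k_def by (rule tri)
    also have "\<dots> \<le> N + excess m \<omega> * N + excess m \<omega> * N"
      unfolding abs_mult[of ?e] using e A B C by (intro add_mono mult_mono) auto
    also have "\<dots> \<le> 2 * N * (1 + excess m \<omega>)" using N(1) by (simp add: algebra_simps)
    finally have K: "\<bar>k r (Y \<omega>)\<bar> \<le> 2 * N * (1 + excess m \<omega>)" .
    have "\<bar>lam * exp (lam * r) * k r (Y \<omega>)\<bar> = lam * exp (lam * r) * \<bar>k r (Y \<omega>)\<bar>"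
      using rate_positive by (simp add: abs_mult)
    also have "\<dots> \<le> ?Z \<omega>"
      using rate_positive r by (intro mult_mono K mult_nonneg_nonneg) auto
    finally show "\<bar>lam * exp (lam * r) * k r (Y \<omega>)\<bar> \<le> ?Z \<omega>" .
  qed (rule second_moment_kernel[OF s])
  moreover have "expectation ?H = exp (lam * s) * ((p s)\<^sup>2 + phi (p s) * U s) - ((p 0)\<^sup>2 + phi (p 0) * U 0)"
    by (simp add: excess_integrable prob_space phi_eq[symmetric])
  ultimately show ?thesis by (simp add: expectation_k)
qed

end

text \<open>
  Thresholds at times \<open>r \<le> 0\<close> are never consulted, so the policy may be replaced by its continuous
  extension.
\<close>

lemma sale_price_threshold_cong:
  assumes "\<And>r. r > 0 \<Longrightarrow> m r = m' r"
  shows "sale_price m X D t = sale_price m' X D t"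
proof -
  have "accepted m X D t = accepted m' X D t"
    using assms by (auto simp: accepted_def fun_eq_iff)
  then show ?thesis by (simp add: sale_price_def fun_eq_iff)
qed

theorem theorem3p2:
  fixes M :: "'a measure" and lam t :: real and F F0 :: "real \<Rightarrow> real"
    and Y :: "'a \<Rightarrow> real" and X D :: "nat \<Rightarrow> 'a \<Rightarrow> real"
  defines "\<mu>\<^sub>0 \<equiv> prob_space.expectation M (X 0)"
    and "\<mu> \<equiv> optimal_policy lam F (prob_space.expectation M (X 0))"
    and "S \<equiv> sale_price (optimal_policy lam F (prob_space.expectation M (X 0))) X D t"
    and "\<phi> \<equiv> tail_integral F"
  assumes "bidding_process M lam F F0 Y X D"
    and "integrable M (\<lambda>\<omega>. (X 0 \<omega>)\<^sup>2)"
    and "integrable M (\<lambda>\<omega>. (max (Y \<omega>) 0)\<^sup>2)"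
    and "t \<ge> 0"
  shows
    "integrable M S \<and>
     integrable M (\<lambda>\<omega>. (S \<omega> - prob_space.expectation M S)\<^sup>2) \<and>
     (\<forall>w\<in>{\<mu>\<^sub>0..\<mu> t}. interval_lebesgue_integrable lborel (ereal w) \<infinity> \<phi>) \<and>
     interval_lebesgue_integrable lborel (ereal \<mu>\<^sub>0) (ereal (\<mu> t))
       (\<lambda>w. 1 / (\<phi> w)\<^sup>2 * (LBINT x=ereal w..\<infinity>. \<phi> x)) \<and>
     prob_space.variance M S =
       \<phi> (\<mu> t) * (prob_space.variance M (X 0) / \<phi> \<mu>\<^sub>0
         + 2 * (LBINT w=ereal \<mu>\<^sub>0..ereal (\<mu> t). 1 / (\<phi> w)\<^sup>2 * (LBINT x=ereal w..\<infinity>. \<phi> x))) \<and>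
     interval_lebesgue_integrable lborel (ereal \<mu>\<^sub>0) (ereal (\<mu> t))
       (\<lambda>w. prob_space.variance M (\<lambda>\<omega>. max (Y \<omega> - w) 0)
          / (prob_space.expectation M (\<lambda>\<omega>. max (Y \<omega> - w) 0))\<^sup>2) \<and>
     prob_space.variance M S =
       prob_space.expectation M (\<lambda>\<omega>. max (Y \<omega> - \<mu> t) 0) *
       (\<mu> t - \<mu>\<^sub>0
         + prob_space.variance M (X 0) / prob_space.expectation M (\<lambda>\<omega>. max (Y \<omega> - \<mu>\<^sub>0) 0)
         + (LBINT w=ereal \<mu>\<^sub>0..ereal (\<mu> t).
              prob_space.variance M (\<lambda>\<omega>. max (Y \<omega> - w) 0)
                / (prob_space.expectation M (\<lambda>\<omega>. max (Y \<omega> - w) 0))\<^sup>2))"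
proof -
  interpret bidding_process M lam F F0 Y X D by fact
  note X0_sq = \<open>integrable M (\<lambda>\<omega>. (X 0 \<omega>)\<^sup>2)\<close> and t = \<open>t \<ge> 0\<close>
  \<comment> \<open>With this value the candidate for the second moment starts at the second moment of \<open>X 0\<close>.\<close>
  define c where "c = variance (X 0) / tail_integral F \<mu>\<^sub>0"
  interpret O: optimal_selling M Y F \<mu>\<^sub>0 lam c
    by unfold_locales
       (use Y_measurable Y_cdf Y_pos_integrable assms(7) mean_less rate_pos in \<open>simp_all add: \<mu>\<^sub>0_def\<close>)
  note meas [measurable] = O.measurable_along_policy
  have \<mu>_t: "\<mu> t = O.p t" by (simp only: \<mu>_def O.p_def \<mu>\<^sub>0_def[symmetric] max_absorb1[OF t])
  have S_eq: "S = sale_price O.p X D t"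
    unfolding S_def by (rule sale_price_threshold_cong) (simp add: O.p_def \<mu>\<^sub>0_def[symmetric])
  have \<phi>_pos: "0 < \<phi> (O.p r)" for r using O.phi_p_pos by (simp add: \<phi>_def)
  have \<mu>\<^sub>0_nonneg: "0 \<le> \<mu>\<^sub>0" using mean_nonneg by (simp add: \<mu>\<^sub>0_def)
  have var0: "expectation (\<lambda>\<omega>. (X 0 \<omega>)\<^sup>2) = \<mu>\<^sub>0\<^sup>2 + \<phi> \<mu>\<^sub>0 * c"
  proof -
    have "\<phi> \<mu>\<^sub>0 * c = variance (X 0)"
      using \<phi>_pos[of 0] unfolding O.p_start c_def \<phi>_def by simp
    then show ?thesis
      using variance_eq[OF X_0_integrable X0_sq] unfolding \<mu>\<^sub>0_def by simp
  qed
  have payoff1: "integrable M (\<lambda>\<omega>. indicator {\<mu>\<^sub>0..} (Y \<omega>) * Y \<omega>)"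
    by (rule Bochner_Integration.integrable_bound[OF Y_pos_integrable])
       (use \<mu>\<^sub>0_nonneg Y_measurable in \<open>auto simp: indicator_def\<close>)
  have payoff2: "integrable M (\<lambda>\<omega>. indicator {\<mu>\<^sub>0..} (Y \<omega>) * (Y \<omega>)\<^sup>2)"
    by (rule Bochner_Integration.integrable_bound[OF assms(7)])
       (use \<mu>\<^sub>0_nonneg Y_measurable in \<open>auto simp: indicator_def\<close>)
  obtain B1 where B1: "\<And>r. 0 \<le> r \<Longrightarrow> r \<le> t \<Longrightarrow> \<bar>O.p r\<bar> \<le> B1"
    using continuous_on_interval_bounded[OF O.p_continuous] by blast
  let ?v = "\<lambda>r. (O.p r)\<^sup>2 + tail_integral F (O.p r) * O.U r"
  have "continuous_on {0..t} ?v"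
    by (intro continuous_intros O.p_continuous O.phi_p_continuous O.U_continuous)
  then obtain B2 where B2: "\<And>r. 0 \<le> r \<Longrightarrow> r \<le> t \<Longrightarrow> \<bar>?v r\<bar> \<le> B2"
    using continuous_on_interval_bounded by blast
  have start: "O.p 0 = \<mu>\<^sub>0" "O.U 0 = c" by (rule O.p_start O.U_start)+
  have mean: "threshold_policy M lam F F0 Y X D t O.p (\<lambda>x. x) O.p \<mu>\<^sub>0 B1"
  proof unfold_locales
    show "O.p 0 = expectation (X 0)" using start(1) by (simp only: \<mu>\<^sub>0_def)
    show "0 \<le> x" if "\<mu>\<^sub>0 \<le> x" for x using that \<mu>\<^sub>0_nonneg by simp
    show "\<bar>O.p r\<bar> \<le> B1" if "0 \<le> r" "r \<le> t" for r using that by (rule B1)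
    show "((\<lambda>r. lam * exp (lam * r) * expectation (\<lambda>\<omega>. if O.p r \<le> Y \<omega> then Y \<omega> else O.p r))
        has_integral (exp (lam * s) * O.p s - O.p 0)) {0..s}" if "0 \<le> s" for s
      using that by (rule O.mean_equation)
  qed (rule t meas measurable_ident_sets[OF refl] O.p_ge payoff1 X_0_integrable)+
  have square: "threshold_policy M lam F F0 Y X D t O.p (\<lambda>x. x\<^sup>2) ?v \<mu>\<^sub>0 B2"
  proof unfold_locales
    show "?v 0 = expectation (\<lambda>\<omega>. (X 0 \<omega>)\<^sup>2)" unfolding start var0 \<phi>_def ..
    show "(\<lambda>x :: real. x\<^sup>2) \<in> borel_measurable borel" "?v \<in> borel_measurable borel" by measurable
    show "\<bar>?v r\<bar> \<le> B2" if "0 \<le> r" "r \<le> t" for r using that by (rule B2)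
    show "((\<lambda>r. lam * exp (lam * r) * expectation (\<lambda>\<omega>. if O.p r \<le> Y \<omega> then (Y \<omega>)\<^sup>2 else ?v r))
        has_integral (exp (lam * s) * ?v s - ?v 0)) {0..s}" if "0 \<le> s" for s
      using that by (rule O.second_moment_equation)
  qed (rule t meas O.p_ge payoff2 X0_sq zero_le_power2)+
  have S_int: "integrable M S" and ES: "expectation S = O.p t"
    using threshold_policy.expectation_sale_price[OF mean] by (simp_all add: S_eq)
  have S2_int: "integrable M (\<lambda>\<omega>. (S \<omega>)\<^sup>2)" and ES2: "expectation (\<lambda>\<omega>. (S \<omega>)\<^sup>2) = ?v t"
    using threshold_policy.expectation_sale_price[OF square] by (simp_all add: S_eq)
  have var: "variance S = \<phi> (\<mu> t) * O.U t"
    using variance_eq[OF S_int S2_int] by (simp add: ES ES2 \<mu>_t \<phi>_def)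
  have dev_int: "integrable M (\<lambda>\<omega>. (S \<omega> - expectation S)\<^sup>2)"
    using S_int S2_int by (simp add: power2_diff)
  let ?Phi = "\<lambda>w. LBINT x=ereal w..\<infinity>. \<phi> x"
  have le: "\<mu>\<^sub>0 \<le> \<mu> t" using O.p_ge[of t] by (simp add: \<mu>_t)
  have cont: "continuous_on {\<mu>\<^sub>0..\<mu> t} (\<lambda>w. 1 / (\<phi> w)\<^sup>2 * ?Phi w)"
    unfolding \<phi>_def by (rule O.continuous_rate) (simp add: \<mu>_t O.p_less)
  have I1: "interval_lebesgue_integrable lborel (ereal \<mu>\<^sub>0) (ereal (\<mu> t)) (\<lambda>w. 1 / (\<phi> w)\<^sup>2 * ?Phi w)"
    by (rule interval_integrable_continuous_on[OF le cont])
  have first: "variance S = \<phi> (\<mu> t) * (variance (X 0) / \<phi> \<mu>\<^sub>0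
         + 2 * (LBINT w=ereal \<mu>\<^sub>0..ereal (\<mu> t). 1 / (\<phi> w)\<^sup>2 * ?Phi w))"
    unfolding var O.U_def O.J_def unfolding c_def \<phi>_def \<mu>_t ..
  have ratio: "variance (\<lambda>\<omega>. max (Y \<omega> - w) 0) / (expectation (\<lambda>\<omega>. max (Y \<omega> - w) 0))\<^sup>2
      = 2 * (1 / (\<phi> w)\<^sup>2 * ?Phi w) - 1" if "w \<le> \<mu> t" for w
  proof -
    have "w \<le> O.p t" using that by (simp only: \<mu>_t)
    then have pos: "0 < tail_integral F w" by (rule O.phi_pos[OF O.endpoint_mono[OF O.p_less]])
    have split: "(2 * y - x\<^sup>2) / x\<^sup>2 = 2 * (1 / x\<^sup>2 * y) - 1" if "0 < x" for x y :: real
      using that by (simp add: diff_divide_distrib)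
    show ?thesis
      unfolding O.variance_excess unfolding O.phi_eq[symmetric] \<phi>_def by (rule split[OF pos])
  qed
  have cont2: "continuous_on {\<mu>\<^sub>0..\<mu> t} (\<lambda>w. variance (\<lambda>\<omega>. max (Y \<omega> - w) 0) / (expectation (\<lambda>\<omega>. max (Y \<omega> - w) 0))\<^sup>2)"
  proof (rule continuous_on_eq)
    show "continuous_on {\<mu>\<^sub>0..\<mu> t} (\<lambda>w. 2 * (1 / (\<phi> w)\<^sup>2 * ?Phi w) - 1)"
      by (intro continuous_on_diff continuous_on_mult_left cont continuous_on_const)
    show "2 * (1 / (\<phi> w)\<^sup>2 * ?Phi w) - 1
        = variance (\<lambda>\<omega>. max (Y \<omega> - w) 0) / (expectation (\<lambda>\<omega>. max (Y \<omega> - w) 0))\<^sup>2"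
      if "w \<in> {\<mu>\<^sub>0..\<mu> t}" for w
      by (rule ratio[symmetric]) (use that in simp)
  qed
  have I2: "interval_lebesgue_integrable lborel (ereal \<mu>\<^sub>0) (ereal (\<mu> t))
      (\<lambda>w. variance (\<lambda>\<omega>. max (Y \<omega> - w) 0) / (expectation (\<lambda>\<omega>. max (Y \<omega> - w) 0))\<^sup>2)"
    by (rule interval_integrable_continuous_on[OF le cont2])
  have "(LBINT w=ereal \<mu>\<^sub>0..ereal (\<mu> t). variance (\<lambda>\<omega>. max (Y \<omega> - w) 0) / (expectation (\<lambda>\<omega>. max (Y \<omega> - w) 0))\<^sup>2)
      = (LBINT w=ereal \<mu>\<^sub>0..ereal (\<mu> t). 2 * (1 / (\<phi> w)\<^sup>2 * ?Phi w) - 1)"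
  proof (rule interval_integral_cong)
    fix w assume "w \<in> einterval (min (ereal \<mu>\<^sub>0) (ereal (\<mu> t))) (max (ereal \<mu>\<^sub>0) (ereal (\<mu> t)))"
    then have "w \<le> \<mu> t" using le by (simp add: einterval_iff)
    then show "variance (\<lambda>\<omega>. max (Y \<omega> - w) 0) / (expectation (\<lambda>\<omega>. max (Y \<omega> - w) 0))\<^sup>2
        = 2 * (1 / (\<phi> w)\<^sup>2 * ?Phi w) - 1" by (rule ratio)
  qed
  also have "\<dots> = 2 * (LBINT w=ereal \<mu>\<^sub>0..ereal (\<mu> t). 1 / (\<phi> w)\<^sup>2 * ?Phi w) - (\<mu> t - \<mu>\<^sub>0)"
    by (simp only: interval_lebesgue_integral_diff(2)[OF interval_lebesgue_integrable_mult_right[OF I1] interval_integral_const(1)]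
        interval_lebesgue_integral_mult_right interval_integral_const(2) mult_1_left)
  finally have ratio_integral: "(LBINT w=ereal \<mu>\<^sub>0..ereal (\<mu> t). variance (\<lambda>\<omega>. max (Y \<omega> - w) 0) / (expectation (\<lambda>\<omega>. max (Y \<omega> - w) 0))\<^sup>2)
      = 2 * (LBINT w=ereal \<mu>\<^sub>0..ereal (\<mu> t). 1 / (\<phi> w)\<^sup>2 * ?Phi w) - (\<mu> t - \<mu>\<^sub>0)" .
  have regroup: "x * (y + 2 * z) = x * (a - b + y + (2 * z - (a - b)))" for x y z a b :: real
    by simp
  have second: "variance S = expectation (\<lambda>\<omega>. max (Y \<omega> - \<mu> t) 0) *
       (\<mu> t - \<mu>\<^sub>0 + variance (X 0) / expectation (\<lambda>\<omega>. max (Y \<omega> - \<mu>\<^sub>0) 0)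
         + (LBINT w=ereal \<mu>\<^sub>0..ereal (\<mu> t).
              variance (\<lambda>\<omega>. max (Y \<omega> - w) 0) / (expectation (\<lambda>\<omega>. max (Y \<omega> - w) 0))\<^sup>2))"
    unfolding first ratio_integral unfolding O.phi_eq[symmetric] \<phi>_def
    by (rule regroup)
  have phi_int: "interval_lebesgue_integrable lborel (ereal w) \<infinity> \<phi>" for w
    unfolding \<phi>_def by (rule O.phi_integrable)
  show ?thesis
    by (rule conjI[OF S_int conjI[OF dev_int conjI[OF ballI[OF phi_int] conjI[OF I1 conjI[OF first conjI[OF I2 second]]]]]])
qed

end
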